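(* Let $R$ be a 2-fir and let $p$ be an atom of $R$. (a) Let $f\in\mathcal F$. The map $\lambda_{f,p}:R/Rp\to R/Rp$, $x+Rp\mapsto fx+Rp$, is right $C(p)$-linear, its kernel is $\{x+Rp : fx\in Rp\}$, and $\dim_{C(p)}\ker(\lambda_{f,p})\le \ell(f)$. (b) Let $\Delta$ be an $F$-algebraic subset contained in the similarity class $\Delta(p)$. Let $\{p_1,\dots,p_n\}$ be a subset of $\Delta$ (with $p_1,\dots,p_n$ distinct) and, for $i\in\{1,\dots,n\}$, let $\phi_i:R/Rp_i\to R/Rp$ be an isomorphism of left $R$-modules. Then the set $\{p_1,\dots,p_n\}$ is $F$-dependent (i.e. not $F$-independent) if and only if the family $(\phi_1(1+Rp_1),\dots,\phi_n(1+Rp_n))$ is right linearly dependent over $C(p)$. (c) For every $f\in\mathcal F$, $$\dim_{C(p)}\ker(\lambda_{f,p})=rk\bigl(V(f)\cap\Delta(p)\bigr).$$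
   Context: Rings are associative with $1$, not necessarily commutative. A 2-fir is a domain $R$ such that for all $a,b\in R$ with $aR\cap bR\neq 0$ there are $c,d\in R$ with $aR\cap bR=cR$ and $aR+bR=dR$ (this condition is left-right symmetric). $U(R)$ is the group of units. An atom is a nonzero non-unit that is not a product of two non-units; $\mathcal A$ is the set of atoms. The length $\ell(a)$ of $a$ is the least $n$ such that $a$ is a product of $n$ atoms, $0$ if $a$ is a unit, and $\infty$ if $a$ is neither a unit nor a finite product of atoms; $\mathcal F=\{x\in R: \ell(x)<\infty\}$ (so $0\notin\mathcal F$, $U(R)\subseteq\mathcal F$). Nonzero elements $a,a'$ are similar if $R/Ra\cong R/Ra'$ as left $R$-modules; $\Delta(a)$ denotes the similarity class of $a$. The intersection of an empty family of left ideals is $R$. For an atom $p$, $C(p):=\mathrm{End}_R(R/Rp)$ is a division ring; endomorphisms are written on the right of their arguments, so that $R/Rp$ is a left $R$-, right $C(p)$-bimodule, in particular a right $C(p)$-vector space. A subset $\Delta\subseteq\mathcal F\setminus U(R)$ is $F$-algebraic if $\bigcap_{\delta\in\Delta}R\delta\neq0$. For $\Delta$ $F$-algebraic, $d\in\mathcal F$ is $F$-dependent on $\Delta$ if $\Delta\cup\{d\}$ is $F$-algebraic and there is a finite subset $\Gamma\subseteq\Delta$ with $Rd+\bigcap_{\gamma\in\Gamma}R\gamma\neq R$. $\Delta$ is $F$-independent if no $\delta\in\Delta$ is $F$-dependent on $\Delta\setminus\{\delta\}$. An $F$-basis of $\Delta$ is an $F$-independent subset $B\subseteq\Delta$ such that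 every element of $\Delta$ is $F$-dependent on $B$. For an $F$-algebraic set $\Delta$ of atoms, $rk(\Delta)=|B|$ for any $F$-basis $B$ of $\Delta$ (every such $\Delta$ has an $F$-basis, and all $F$-bases have the same cardinality). For $a\in R\setminus\{0\}$, $V(a)=\{q\in\mathcal A: a\in Rq\}$, an $F$-algebraic set. *)

theory Defs
  imports "HOL-Algebra.Ideal" "HOL-Algebra.Module" "HOL-Library.Extended_Nat"
begin

section \<open>2-firs, atoms, length\<close>

definition left_ideal_gen :: "('a, 'm) ring_scheme \<Rightarrow> 'a \<Rightarrow> 'a set" where
  "left_ideal_gen R a = {r \<otimes>\<^bsub>R\<^esub> a | r. r \<in> carrier R}"

definition right_ideal_gen :: "('a, 'm) ring_scheme \<Rightarrow> 'a \<Rightarrow> 'a set" where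
  "right_ideal_gen R a = {a \<otimes>\<^bsub>R\<^esub> r | r. r \<in> carrier R}"

text \<open>The library locale \<^locale>\<open>domain\<close> assumes commutativity, so the domain axioms are
  repeated here for \<^locale>\<open>ring\<close>.\<close>

locale two_fir = ring R for R (structure) +
  assumes one_not_zero: "\<one> \<noteq> \<zero>"
    and no_zero_divisors: "\<lbrakk>a \<in> carrier R; b \<in> carrier R; a \<otimes> b = \<zero>\<rbrakk> \<Longrightarrow> a = \<zero> \<or> b = \<zero>"
    and right_ideals_principal:
      "\<lbrakk>a \<in> carrier R; b \<in> carrier R; right_ideal_gen R a \<inter> right_ideal_gen R b \<noteq> {\<zero>}\<rbrakk> \<Longrightarrow>
        \<exists>c\<in>carrier R. \<exists>d\<in>carrier R.
          right_ideal_gen R a \<inter> right_ideal_gen R b = right_ideal_gen R c \<and>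
          right_ideal_gen R a <+> right_ideal_gen R b = right_ideal_gen R d"

definition atoms :: "('a, 'm) ring_scheme \<Rightarrow> 'a set" where
  "atoms R = {a \<in> carrier R. a \<noteq> \<zero>\<^bsub>R\<^esub> \<and> a \<notin> Units R \<and>
     \<not> (\<exists>b \<in> carrier R - Units R. \<exists>c \<in> carrier R - Units R. a = b \<otimes>\<^bsub>R\<^esub> c)}"

text \<open>The infimum of the empty set in \<^typ>\<open>enat\<close> is \<^term>\<open>\<infinity>\<close>.\<close>

definition elt_length :: "('a, 'm) ring_scheme \<Rightarrow> 'a \<Rightarrow> enat" where
  "elt_length R a =
     (if a \<in> Units R then 0
      else Inf {enat (length as) | as. set as \<subseteq> atoms R \<and> a = foldr (\<otimes>\<^bsub>R\<^esub>) as \<one>\<^bsub>R\<^esub>})"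

definition finite_length :: "('a, 'm) ring_scheme \<Rightarrow> 'a set" where
  "finite_length R = {x \<in> carrier R. elt_length R x < \<infinity>}"


section \<open>Modules\<close>

text \<open>The record \<^typ>\<open>('a, 'b) module\<close> is used for one-sided modules over rings that need not be
  commutative (the library locale \<^locale>\<open>module\<close> assumes commutativity). Only its additive group and
  its scalar multiplication matter; the fields \<open>mult\<close> and \<open>one\<close> are irrelevant. For a right module,
  \<open>c \<odot> v\<close> stands for the product \<open>v c\<close>.\<close>

text \<open>\<open>R / R a\<close>. On cosets, \<open>r \<odot> (x + R a) = r x + R a\<close>, see \<open>quot_module_smult\<close> below.\<close>

definition quot_module :: "('a, 'm) ring_scheme \<Rightarrow> 'a \<Rightarrow> ('a, 'a set) module" where
  "quot_module R a =
     \<lparr> carrier = a_rcosets\<^bsub>R\<^esub> (left_ideal_gen R a), mult = undefined, one = undefined,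
       zero = left_ideal_gen R a, add = (<+>\<^bsub>R\<^esub>),
       smult = (\<lambda>r X. \<Union>x\<in>X. left_ideal_gen R a +>\<^bsub>R\<^esub> (r \<otimes>\<^bsub>R\<^esub> x)) \<rparr>"

lemma quot_module_smult:
  assumes "ring R" and a: "a \<in> carrier R" and r: "r \<in> carrier R" and x: "x \<in> carrier R"
  shows "r \<odot>\<^bsub>quot_module R a\<^esub> (left_ideal_gen R a +>\<^bsub>R\<^esub> x) = left_ideal_gen R a +>\<^bsub>R\<^esub> (r \<otimes>\<^bsub>R\<^esub> x)"
proof -
  interpret ring R by fact
  let ?I = "left_ideal_gen R a"
  have I_memI: "s \<otimes>\<^bsub>R\<^esub> a \<in> ?I" if "s \<in> carrier R" for s
    using that by (auto simp: left_ideal_gen_def)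
  have I_memE: "\<exists>s\<in>carrier R. u = s \<otimes>\<^bsub>R\<^esub> a" if "u \<in> ?I" for u
    using that by (auto simp: left_ideal_gen_def)
  have sub: "subgroup ?I (add_monoid R)"
  proof (rule add.subgroupI)
    show "?I \<subseteq> carrier R" using a by (auto simp: left_ideal_gen_def)
    show "?I \<noteq> {}" using I_memI[OF zero_closed] by blast
    show "\<ominus>\<^bsub>R\<^esub> u \<in> ?I" if u: "u \<in> ?I" for u
    proof -
      obtain s where s: "s \<in> carrier R" "u = s \<otimes>\<^bsub>R\<^esub> a" using I_memE[OF u] by blast
      then have "\<ominus>\<^bsub>R\<^esub> u = (\<ominus>\<^bsub>R\<^esub> s) \<otimes>\<^bsub>R\<^esub> a" using a by (simp add: l_minus)
      then show ?thesis using I_memI[of "\<ominus>\<^bsub>R\<^esub> s"] s(1) by simp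
    qed
    show "u \<oplus>\<^bsub>R\<^esub> v \<in> ?I" if u: "u \<in> ?I" and v: "v \<in> ?I" for u v
    proof -
      obtain s where s: "s \<in> carrier R" "u = s \<otimes>\<^bsub>R\<^esub> a" using I_memE[OF u] by blast
      obtain t where t: "t \<in> carrier R" "v = t \<otimes>\<^bsub>R\<^esub> a" using I_memE[OF v] by blast
      have "u \<oplus>\<^bsub>R\<^esub> v = (s \<oplus>\<^bsub>R\<^esub> t) \<otimes>\<^bsub>R\<^esub> a" using s t a by (simp add: l_distr)
      then show ?thesis using I_memI[of "s \<oplus>\<^bsub>R\<^esub> t"] s(1) t(1) by simp
    qed
  qed
  interpret I: abelian_subgroup ?I R
    by (rule abelian_subgroupI3)
      (simp_all add: additive_subgroup_def sub abelian_group_axioms)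
  have coset_iff: "u \<in> ?I +>\<^bsub>R\<^esub> z \<longleftrightarrow> (\<exists>s\<in>carrier R. u = s \<otimes>\<^bsub>R\<^esub> a \<oplus>\<^bsub>R\<^esub> z)" for u z
    unfolding a_r_coset_def' left_ideal_gen_def by blast
  have eq: "?I +>\<^bsub>R\<^esub> (r \<otimes>\<^bsub>R\<^esub> y) = ?I +>\<^bsub>R\<^esub> (r \<otimes>\<^bsub>R\<^esub> x)" if y: "y \<in> ?I +>\<^bsub>R\<^esub> x" for y
  proof -
    obtain s where s: "s \<in> carrier R" "y = s \<otimes>\<^bsub>R\<^esub> a \<oplus>\<^bsub>R\<^esub> x"
      using y coset_iff by blast
    have "r \<otimes>\<^bsub>R\<^esub> y = (r \<otimes>\<^bsub>R\<^esub> s) \<otimes>\<^bsub>R\<^esub> a \<oplus>\<^bsub>R\<^esub> r \<otimes>\<^bsub>R\<^esub> x"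
      unfolding s(2) using s(1) a r x by (simp add: r_distr m_assoc)
    then have "r \<otimes>\<^bsub>R\<^esub> y \<in> ?I +>\<^bsub>R\<^esub> (r \<otimes>\<^bsub>R\<^esub> x)"
      using coset_iff m_closed[OF r s(1)] by blast
    then show ?thesis
      by (rule a_repr_independence[OF _ m_closed[OF r x] sub, symmetric])
  qed
  have "x \<in> ?I +>\<^bsub>R\<^esub> x" using x by (rule I.a_rcos_self)
  then have "(\<Union>y\<in>?I +>\<^bsub>R\<^esub> x. ?I +>\<^bsub>R\<^esub> (r \<otimes>\<^bsub>R\<^esub> y)) = ?I +>\<^bsub>R\<^esub> (r \<otimes>\<^bsub>R\<^esub> x)"
    using eq by blast
  then show ?thesis unfolding quot_module_def module.simps .
qed

text \<open>Since sidedness is only a matter of how \<open>\<odot>\<close> is read, this covers homomorphisms of left modules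
  and of right modules.\<close>

definition lin_maps ::
  "('k, 'm) ring_scheme \<Rightarrow> ('k, 'v) module \<Rightarrow> ('k, 'w) module \<Rightarrow> ('v \<Rightarrow> 'w) set" where
  "lin_maps K M N = {h \<in> hom (add_monoid M) (add_monoid N).
     \<forall>k\<in>carrier K. \<forall>x\<in>carrier M. h (k \<odot>\<^bsub>M\<^esub> x) = k \<odot>\<^bsub>N\<^esub> h x}"

definition lin_isos ::
  "('k, 'm) ring_scheme \<Rightarrow> ('k, 'v) module \<Rightarrow> ('k, 'w) module \<Rightarrow> ('v \<Rightarrow> 'w) set" where
  "lin_isos K M N = {h \<in> lin_maps K M N. bij_betw h (carrier M) (carrier N)}"

text \<open>Endomorphisms are made extensional, so that equality of functions is equality on the module.
  They are written on the right: \<open>c \<otimes> d\<close> is first \<open>c\<close>, then \<open>d\<close>.\<close>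

definition End_ring :: "('k, 'm) ring_scheme \<Rightarrow> ('k, 'v) module \<Rightarrow> ('v \<Rightarrow> 'v) ring" where
  "End_ring K M =
     \<lparr> carrier = lin_maps K M M \<inter> extensional (carrier M),
       mult = (\<lambda>c d. compose (carrier M) d c),
       one = (\<lambda>x\<in>carrier M. x),
       zero = (\<lambda>x\<in>carrier M. \<zero>\<^bsub>M\<^esub>),
       add = (\<lambda>c d. \<lambda>x\<in>carrier M. c x \<oplus>\<^bsub>M\<^esub> d x) \<rparr>"

text \<open>A module as a right module over its endomorphism ring, \<open>v c\<close> being the value of \<open>c\<close> at \<open>v\<close>.\<close>

definition End_module :: "('k, 'v) module \<Rightarrow> ('v \<Rightarrow> 'v, 'v) module" where
  "End_module M =
     \<lparr> carrier = carrier M, mult = undefined, one = undefined,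
       zero = zero M, add = add M, smult = (\<lambda>c v. c v) \<rparr>"


section \<open>Linear dependence and dimension\<close>

definition lin_dependent ::
  "('k, 'm) ring_scheme \<Rightarrow> ('k, 'v) module \<Rightarrow> 'i set \<Rightarrow> ('i \<Rightarrow> 'v) \<Rightarrow> bool" where
  "lin_dependent K M I v \<longleftrightarrow>
     (\<exists>c. c \<in> I \<rightarrow> carrier K \<and> (\<exists>i\<in>I. c i \<noteq> \<zero>\<^bsub>K\<^esub>) \<and> (\<Oplus>\<^bsub>M\<^esub>i\<in>I. c i \<odot>\<^bsub>M\<^esub> v i) = \<zero>\<^bsub>M\<^esub>)"

definition lin_basis :: "('k, 'm) ring_scheme \<Rightarrow> ('k, 'v) module \<Rightarrow> 'v set \<Rightarrow> bool" where
  "lin_basis K M B \<longleftrightarrow> B \<subseteq> carrier M \<and>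
     (\<forall>A. finite A \<and> A \<subseteq> B \<longrightarrow> \<not> lin_dependent K M A (\<lambda>v. v)) \<and>
     (\<forall>x\<in>carrier M. \<exists>A c. finite A \<and> A \<subseteq> B \<and> c \<in> A \<rightarrow> carrier K \<and> x = (\<Oplus>\<^bsub>M\<^esub>v\<in>A. c v \<odot>\<^bsub>M\<^esub> v))"

definition ecard :: "'a set \<Rightarrow> enat" where
  "ecard A = (if finite A then enat (card A) else \<infinity>)"

text \<open>The dimension is the common cardinality of all bases; infinite cardinalities are not
  distinguished.\<close>

definition lin_dim :: "('k, 'm) ring_scheme \<Rightarrow> ('k, 'v) module \<Rightarrow> enat" where
  "lin_dim K M = (THE n. \<exists>B. lin_basis K M B \<and> n = ecard B)"


section \<open>The division ring of an atom and left multiplication\<close>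

definition C_ring :: "('a, 'm) ring_scheme \<Rightarrow> 'a \<Rightarrow> ('a set \<Rightarrow> 'a set) ring" where
  "C_ring R p = End_ring R (quot_module R p)"

definition C_space :: "('a, 'm) ring_scheme \<Rightarrow> 'a \<Rightarrow> ('a set \<Rightarrow> 'a set, 'a set) module" where
  "C_space R p = End_module (quot_module R p)"

definition lmult :: "('a, 'm) ring_scheme \<Rightarrow> 'a \<Rightarrow> 'a \<Rightarrow> 'a set \<Rightarrow> 'a set" where
  "lmult R f p = (\<lambda>X. f \<odot>\<^bsub>quot_module R p\<^esub> X)"

definition lmult_ker :: "('a, 'm) ring_scheme \<Rightarrow> 'a \<Rightarrow> 'a \<Rightarrow> 'a set set" where
  "lmult_ker R f p = a_kernel (quot_module R p) (quot_module R p) (lmult R f p)"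

definition lmult_ker_space ::
  "('a, 'm) ring_scheme \<Rightarrow> 'a \<Rightarrow> 'a \<Rightarrow> ('a set \<Rightarrow> 'a set, 'a set) module" where
  "lmult_ker_space R f p = (C_space R p)\<lparr>carrier := lmult_ker R f p\<rparr>"

definition similarity_class :: "('a, 'm) ring_scheme \<Rightarrow> 'a \<Rightarrow> 'a set" where
  "similarity_class R a = {b \<in> carrier R. a \<noteq> \<zero>\<^bsub>R\<^esub> \<and> b \<noteq> \<zero>\<^bsub>R\<^esub> \<and>
     lin_isos R (quot_module R a) (quot_module R b) \<noteq> {}}"


section \<open>F-dependence and rank\<close>

text \<open>The intersection of the empty family is the whole ring.\<close>

definition left_ideal_Inter :: "('a, 'm) ring_scheme \<Rightarrow> 'a set \<Rightarrow> 'a set" where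
  "left_ideal_Inter R D = carrier R \<inter> (\<Inter>d\<in>D. left_ideal_gen R d)"

definition F_algebraic :: "('a, 'm) ring_scheme \<Rightarrow> 'a set \<Rightarrow> bool" where
  "F_algebraic R D \<longleftrightarrow> D \<subseteq> finite_length R - Units R \<and> left_ideal_Inter R D \<noteq> {\<zero>\<^bsub>R\<^esub>}"

definition F_dependent_on :: "('a, 'm) ring_scheme \<Rightarrow> 'a \<Rightarrow> 'a set \<Rightarrow> bool" where
  "F_dependent_on R d D \<longleftrightarrow> d \<in> finite_length R \<and> F_algebraic R D \<and> F_algebraic R (D \<union> {d}) \<and>
     (\<exists>G. finite G \<and> G \<subseteq> D \<and> left_ideal_gen R d <+>\<^bsub>R\<^esub> left_ideal_Inter R G \<noteq> carrier R)"

definition F_independent :: "('a, 'm) ring_scheme \<Rightarrow> 'a set \<Rightarrow> bool" where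
  "F_independent R D \<longleftrightarrow> F_algebraic R D \<and> (\<forall>d\<in>D. \<not> F_dependent_on R d (D - {d}))"

definition F_basis :: "('a, 'm) ring_scheme \<Rightarrow> 'a set \<Rightarrow> 'a set \<Rightarrow> bool" where
  "F_basis R D B \<longleftrightarrow> B \<subseteq> D \<and> F_independent R B \<and> (\<forall>d\<in>D. F_dependent_on R d B)"

text \<open>As for dimensions, infinite ranks are not distinguished.\<close>

definition F_rank :: "('a, 'm) ring_scheme \<Rightarrow> 'a set \<Rightarrow> enat" where
  "F_rank R D = (THE n. \<exists>B. F_basis R D B \<and> n = ecard B)"

definition left_roots :: "('a, 'm) ring_scheme \<Rightarrow> 'a \<Rightarrow> 'a set" where
  "left_roots R a = {q \<in> atoms R. a \<in> left_ideal_gen R q}"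

end

theory Submission
  imports Defs
begin

text \<open>
  Every nonzero torsion element \<open>m\<close> of \<open>M = R/Rp\<close> generates \<open>M\<close>, and its annihilator is \<open>Rq\<close> for
  an atom \<open>q\<close> similar to \<open>p\<close>; conversely, an isomorphism \<open>R/Rq \<cong> M\<close> amounts to the choice of a
  generator of \<open>M\<close> with annihilator \<open>Rq\<close>, which is unique up to a scalar of \<open>C(p)\<close>.
  For torsion elements \<open>m\<^sub>1, \<dots>, m\<^sub>k\<close> with a common nonzero annihilating element, a
  Jacobson-type density argument shows that the common annihilator is principal, \<open>Rg\<close>, and that
  \<open>g m = 0\<close> only for \<open>m\<close> in the \<open>C(p)\<close>-span of the \<open>m\<^sub>i\<close>. As \<open>Rq + Rg \<noteq> R\<close> means
  \<open>g \<in> Rq\<close> for an atom \<open>q\<close>, F-dependence is linear dependence of the corresponding elements, which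
  gives (b) and, by choosing representatives of all roots of \<open>f\<close>, (c). The bound in (a) holds
  because left multiplication by an atom has a kernel of dimension at most 1.
\<close>

section \<open>Linear algebra over a division ring\<close>

text \<open>Torsion shapes every statement. A 2-fir relates two principal ideals only when they meet
  nontrivially, and R/Rp may contain nonzero elements with zero annihilator. So a nonzero f killing
  the elements at hand is always carried along: the common left multiple that an F-algebraic set
  supplies, or the f whose kernel is studied. Torsion then does the work that simplicity does in
  Schur's lemma and in the density theorem. Linear dependence is developed for indexed families,
  since each atom comes with one chosen element of R/Rp; removing an atom from a set then becomes
  removing an index. No separate exchange theory for F-bases is built. Existence and equal
  cardinality of the F-bases of the roots of f in the class of p are inherited from linear algebra,
  and finiteness comes from the bound by the length of f.\<close>

definition lin_span :: "('k, 'm) ring_scheme \<Rightarrow> ('k, 'v) module \<Rightarrow> 'i set \<Rightarrow> ('i \<Rightarrow> 'v) \<Rightarrow> 'v set" where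
  "lin_span K M I v = {\<Oplus>\<^bsub>M\<^esub>i\<in>I. c i \<odot>\<^bsub>M\<^esub> v i | c. c \<in> I \<rightarrow> carrier K}"

text \<open>Scalars stand to the left of \<open>\<odot>\<close> but act on the right, so
  \<open>smult_assoc\<close> reads (v c) d = v (c d) and reverses the visible order. Right inverses
  are what strips a coefficient: v = (v c) d when c d = 1.\<close>

locale right_vector_space = K: ring K + M: abelian_group M
  for K :: "('k, 'm) ring_scheme" and M :: "('k, 'v) module" +
  assumes smult_closed [simp, intro]:
      "\<lbrakk>c \<in> carrier K; v \<in> carrier M\<rbrakk> \<Longrightarrow> c \<odot>\<^bsub>M\<^esub> v \<in> carrier M"
    and smult_r_distr:
      "\<lbrakk>c \<in> carrier K; v \<in> carrier M; w \<in> carrier M\<rbrakk> \<Longrightarrow>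
        c \<odot>\<^bsub>M\<^esub> (v \<oplus>\<^bsub>M\<^esub> w) = c \<odot>\<^bsub>M\<^esub> v \<oplus>\<^bsub>M\<^esub> c \<odot>\<^bsub>M\<^esub> w"
    and smult_l_distr:
      "\<lbrakk>c \<in> carrier K; d \<in> carrier K; v \<in> carrier M\<rbrakk> \<Longrightarrow>
        (c \<oplus>\<^bsub>K\<^esub> d) \<odot>\<^bsub>M\<^esub> v = c \<odot>\<^bsub>M\<^esub> v \<oplus>\<^bsub>M\<^esub> d \<odot>\<^bsub>M\<^esub> v"
    and smult_one [simp]: "v \<in> carrier M \<Longrightarrow> \<one>\<^bsub>K\<^esub> \<odot>\<^bsub>M\<^esub> v = v"
    and smult_assoc:
      "\<lbrakk>c \<in> carrier K; d \<in> carrier K; v \<in> carrier M\<rbrakk> \<Longrightarrow>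
        d \<odot>\<^bsub>M\<^esub> (c \<odot>\<^bsub>M\<^esub> v) = (c \<otimes>\<^bsub>K\<^esub> d) \<odot>\<^bsub>M\<^esub> v"
    and one_neq_zero: "\<one>\<^bsub>K\<^esub> \<noteq> \<zero>\<^bsub>K\<^esub>"
    and right_inverse:
      "\<lbrakk>c \<in> carrier K; c \<noteq> \<zero>\<^bsub>K\<^esub>\<rbrakk> \<Longrightarrow> \<exists>d\<in>carrier K. c \<otimes>\<^bsub>K\<^esub> d = \<one>\<^bsub>K\<^esub>"
begin

lemma smult_zero_left [simp]: "v \<in> carrier M \<Longrightarrow> \<zero>\<^bsub>K\<^esub> \<odot>\<^bsub>M\<^esub> v = \<zero>\<^bsub>M\<^esub>"
  using smult_l_distr[of "\<zero>\<^bsub>K\<^esub>" "\<zero>\<^bsub>K\<^esub>" v] M.add.l_cancel_one'[of "\<zero>\<^bsub>K\<^esub> \<odot>\<^bsub>M\<^esub> v" "\<zero>\<^bsub>K\<^esub> \<odot>\<^bsub>M\<^esub> v"]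
  by simp

lemma smult_zero_right [simp]: "c \<in> carrier K \<Longrightarrow> c \<odot>\<^bsub>M\<^esub> \<zero>\<^bsub>M\<^esub> = \<zero>\<^bsub>M\<^esub>"
  using smult_r_distr[of c "\<zero>\<^bsub>M\<^esub>" "\<zero>\<^bsub>M\<^esub>"] M.add.l_cancel_one'[of "c \<odot>\<^bsub>M\<^esub> \<zero>\<^bsub>M\<^esub>" "c \<odot>\<^bsub>M\<^esub> \<zero>\<^bsub>M\<^esub>"]
  by simp

lemma smult_minus_left:
  assumes "c \<in> carrier K" "v \<in> carrier M"
  shows "(\<ominus>\<^bsub>K\<^esub> c) \<odot>\<^bsub>M\<^esub> v = \<ominus>\<^bsub>M\<^esub> (c \<odot>\<^bsub>M\<^esub> v)"
proof -
  have "(\<ominus>\<^bsub>K\<^esub> c) \<odot>\<^bsub>M\<^esub> v \<oplus>\<^bsub>M\<^esub> c \<odot>\<^bsub>M\<^esub> v = \<zero>\<^bsub>M\<^esub>"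
    using assms by (simp add: smult_l_distr[symmetric] K.l_neg)
  then show ?thesis using assms by (intro M.minus_equality[symmetric]) auto
qed

lemma smult_minus_right:
  assumes "c \<in> carrier K" "v \<in> carrier M"
  shows "c \<odot>\<^bsub>M\<^esub> (\<ominus>\<^bsub>M\<^esub> v) = \<ominus>\<^bsub>M\<^esub> (c \<odot>\<^bsub>M\<^esub> v)"
proof -
  have "c \<odot>\<^bsub>M\<^esub> (\<ominus>\<^bsub>M\<^esub> v) \<oplus>\<^bsub>M\<^esub> c \<odot>\<^bsub>M\<^esub> v = \<zero>\<^bsub>M\<^esub>"
    using assms by (simp add: smult_r_distr[symmetric] M.l_neg)
  then show ?thesis using assms by (intro M.minus_equality[symmetric]) auto
qed

lemma finsum_smult:
  assumes "finite I" "v \<in> I \<rightarrow> carrier M" "a \<in> carrier K"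
  shows "a \<odot>\<^bsub>M\<^esub> (\<Oplus>\<^bsub>M\<^esub>i\<in>I. v i) = (\<Oplus>\<^bsub>M\<^esub>i\<in>I. a \<odot>\<^bsub>M\<^esub> v i)"
  using assms
  by (induction I rule: finite_induct)
    (auto simp: M.finsum_insert smult_r_distr Pi_iff M.finsum_closed)

lemma finsum_smult_left:
  assumes "finite I" "c \<in> I \<rightarrow> carrier K" "v \<in> carrier M"
  shows "(\<Oplus>\<^bsub>K\<^esub>i\<in>I. c i) \<odot>\<^bsub>M\<^esub> v = (\<Oplus>\<^bsub>M\<^esub>i\<in>I. c i \<odot>\<^bsub>M\<^esub> v)"
  using assms
  by (induction I rule: finite_induct)
    (auto simp: M.finsum_insert K.finsum_insert smult_l_distr Pi_iff K.finsum_closed)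

section \<open>Spans of finite families\<close>

lemma span_I:
  "\<lbrakk>c \<in> I \<rightarrow> carrier K; x = (\<Oplus>\<^bsub>M\<^esub>i\<in>I. c i \<odot>\<^bsub>M\<^esub> v i)\<rbrakk> \<Longrightarrow> x \<in> lin_span K M I v"
  by (auto simp: lin_span_def)

lemma span_E:
  assumes "x \<in> lin_span K M I v"
  obtains c where "c \<in> I \<rightarrow> carrier K" "x = (\<Oplus>\<^bsub>M\<^esub>i\<in>I. c i \<odot>\<^bsub>M\<^esub> v i)"
  using assms by (auto simp: lin_span_def)

lemma span_closed: "\<lbrakk>v \<in> I \<rightarrow> carrier M; x \<in> lin_span K M I v\<rbrakk> \<Longrightarrow> x \<in> carrier M"
  by (erule span_E) (auto simp: Pi_iff intro!: M.finsum_closed)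

lemma span_empty [simp]: "lin_span K M {} v = {\<zero>\<^bsub>M\<^esub>}"
  by (auto simp: lin_span_def)

lemma span_zero: "v \<in> I \<rightarrow> carrier M \<Longrightarrow> \<zero>\<^bsub>M\<^esub> \<in> lin_span K M I v"
  by (rule span_I[of "\<lambda>_. \<zero>\<^bsub>K\<^esub>"]) (auto simp: Pi_iff cong: M.finsum_cong)

lemma span_add:
  assumes v: "v \<in> I \<rightarrow> carrier M" and x: "x \<in> lin_span K M I v" and y: "y \<in> lin_span K M I v"
  shows "x \<oplus>\<^bsub>M\<^esub> y \<in> lin_span K M I v"
proof -
  obtain c where c: "c \<in> I \<rightarrow> carrier K" "x = (\<Oplus>\<^bsub>M\<^esub>i\<in>I. c i \<odot>\<^bsub>M\<^esub> v i)" using x by (rule span_E)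
  obtain d where d: "d \<in> I \<rightarrow> carrier K" "y = (\<Oplus>\<^bsub>M\<^esub>i\<in>I. d i \<odot>\<^bsub>M\<^esub> v i)" using y by (rule span_E)
  have "(\<Oplus>\<^bsub>M\<^esub>i\<in>I. (c i \<oplus>\<^bsub>K\<^esub> d i) \<odot>\<^bsub>M\<^esub> v i) = (\<Oplus>\<^bsub>M\<^esub>i\<in>I. c i \<odot>\<^bsub>M\<^esub> v i \<oplus>\<^bsub>M\<^esub> d i \<odot>\<^bsub>M\<^esub> v i)"
    using v c d by (intro M.finsum_cong') (auto simp: smult_l_distr Pi_iff)
  also have "\<dots> = x \<oplus>\<^bsub>M\<^esub> y"
    unfolding c d using v c(1) d(1) by (intro M.finsum_addf) (auto simp: Pi_iff)
  finally show ?thesis using c(1) d(1) by (intro span_I[of "\<lambda>i. c i \<oplus>\<^bsub>K\<^esub> d i"]) auto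
qed

lemma span_smult:
  assumes "finite I" and v: "v \<in> I \<rightarrow> carrier M" and x: "x \<in> lin_span K M I v" and a: "a \<in> carrier K"
  shows "a \<odot>\<^bsub>M\<^esub> x \<in> lin_span K M I v"
proof -
  obtain c where c: "c \<in> I \<rightarrow> carrier K" "x = (\<Oplus>\<^bsub>M\<^esub>i\<in>I. c i \<odot>\<^bsub>M\<^esub> v i)" using x by (rule span_E)
  have "a \<odot>\<^bsub>M\<^esub> x = (\<Oplus>\<^bsub>M\<^esub>i\<in>I. a \<odot>\<^bsub>M\<^esub> (c i \<odot>\<^bsub>M\<^esub> v i))"
    unfolding c using assms(1) v c(1) a by (intro finsum_smult) (auto simp: Pi_iff)
  also have "\<dots> = (\<Oplus>\<^bsub>M\<^esub>i\<in>I. (c i \<otimes>\<^bsub>K\<^esub> a) \<odot>\<^bsub>M\<^esub> v i)"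
    using v c(1) a by (intro M.finsum_cong') (auto simp: smult_assoc Pi_iff)
  finally show ?thesis using c(1) a by (intro span_I[of "\<lambda>i. c i \<otimes>\<^bsub>K\<^esub> a"]) auto
qed

lemma span_minus:
  assumes "finite I" "v \<in> I \<rightarrow> carrier M" "x \<in> lin_span K M I v"
  shows "\<ominus>\<^bsub>M\<^esub> x \<in> lin_span K M I v"
proof -
  have "(\<ominus>\<^bsub>K\<^esub> \<one>\<^bsub>K\<^esub>) \<odot>\<^bsub>M\<^esub> x = \<ominus>\<^bsub>M\<^esub> x"
    using smult_minus_left[of "\<one>\<^bsub>K\<^esub>" x] span_closed[OF assms(2,3)] by simp
  then show ?thesis using span_smult[OF assms, of "\<ominus>\<^bsub>K\<^esub> \<one>\<^bsub>K\<^esub>"] by simp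
qed

lemma span_insert_I:
  assumes "finite I" "i \<notin> I" "v \<in> insert i I \<rightarrow> carrier M" "a \<in> carrier K" "x \<in> lin_span K M I v"
  shows "a \<odot>\<^bsub>M\<^esub> v i \<oplus>\<^bsub>M\<^esub> x \<in> lin_span K M (insert i I) v"
proof -
  obtain c where c: "c \<in> I \<rightarrow> carrier K" "x = (\<Oplus>\<^bsub>M\<^esub>i\<in>I. c i \<odot>\<^bsub>M\<^esub> v i)"
    using assms(5) by (rule span_E)
  have "(\<Oplus>\<^bsub>M\<^esub>k\<in>I. (c(i := a)) k \<odot>\<^bsub>M\<^esub> v k) = x"
    unfolding c using assms c(1) by (intro M.finsum_cong') (auto simp: Pi_iff)
  then have "(\<Oplus>\<^bsub>M\<^esub>k\<in>insert i I. (c(i := a)) k \<odot>\<^bsub>M\<^esub> v k) = a \<odot>\<^bsub>M\<^esub> v i \<oplus>\<^bsub>M\<^esub> x"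
    using assms c(1) by (subst M.finsum_insert) (auto simp: Pi_iff)
  then show ?thesis using assms(4) c(1)
    by (intro span_I[of "c(i := a)"]) auto
qed

lemma span_insert_E:
  assumes "finite I" "i \<notin> I" "v \<in> insert i I \<rightarrow> carrier M" "x \<in> lin_span K M (insert i I) v"
  obtains a y where "a \<in> carrier K" "y \<in> lin_span K M I v" "x = a \<odot>\<^bsub>M\<^esub> v i \<oplus>\<^bsub>M\<^esub> y"
proof -
  obtain c where c: "c \<in> insert i I \<rightarrow> carrier K" "x = (\<Oplus>\<^bsub>M\<^esub>i\<in>insert i I. c i \<odot>\<^bsub>M\<^esub> v i)"
    using assms(4) by (rule span_E)
  have "x = c i \<odot>\<^bsub>M\<^esub> v i \<oplus>\<^bsub>M\<^esub> (\<Oplus>\<^bsub>M\<^esub>i\<in>I. c i \<odot>\<^bsub>M\<^esub> v i)"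
    unfolding c(2) using assms c(1) by (subst M.finsum_insert) (auto simp: Pi_iff)
  then show ?thesis using c(1) by (intro that[of "c i"]) (auto intro: span_I)
qed

lemma span_member:
  assumes "finite I" "v \<in> I \<rightarrow> carrier M" "i \<in> I"
  shows "v i \<in> lin_span K M I v"
  using span_insert_I[of "I - {i}" i v "\<one>\<^bsub>K\<^esub>" "\<zero>\<^bsub>M\<^esub>"] span_zero[of v "I - {i}"] assms
  by (auto simp: insert_absorb Pi_iff)

lemma span_mono:
  assumes "finite I" "J \<subseteq> I" "v \<in> I \<rightarrow> carrier M"
  shows "lin_span K M J v \<subseteq> lin_span K M I v"
proof
  fix x assume x: "x \<in> lin_span K M J v"
  have "x \<in> lin_span K M (J \<union> A) v" if "finite A" "A \<subseteq> I - J" for A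
    using that
  proof (induction A rule: finite_induct)
    case empty
    then show ?case using x by simp
  next
    case (insert a A)
    have v: "v \<in> insert a (J \<union> A) \<rightarrow> carrier M" using assms insert by auto
    have "x \<in> carrier M" using span_closed[OF _ x] assms by (auto simp: Pi_iff)
    then have "x = \<zero>\<^bsub>K\<^esub> \<odot>\<^bsub>M\<^esub> v a \<oplus>\<^bsub>M\<^esub> x" using v by (auto simp: Pi_iff)
    then show ?case
      using span_insert_I[of "J \<union> A" a v "\<zero>\<^bsub>K\<^esub>" x] v insert assms finite_subset[of J I] by auto
  qed
  from this[of "I - J"] show "x \<in> lin_span K M I v"
    using assms by (simp add: Un_absorb1)
qed

section \<open>Linear dependence, elimination and exchange\<close>

lemma span_of_relation:
  assumes "finite I" "i \<notin> I" "v \<in> insert i I \<rightarrow> carrier M" "c \<in> insert i I \<rightarrow> carrier K"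
    and "c i \<noteq> \<zero>\<^bsub>K\<^esub>" and rel: "(\<Oplus>\<^bsub>M\<^esub>k\<in>insert i I. c k \<odot>\<^bsub>M\<^esub> v k) = \<zero>\<^bsub>M\<^esub>"
  shows "v i \<in> lin_span K M I v"
proof -
  let ?s = "\<Oplus>\<^bsub>M\<^esub>k\<in>I. c k \<odot>\<^bsub>M\<^esub> v k"
  have s: "?s \<in> lin_span K M I v" using assms(4) by (intro span_I[of c]) auto
  have sM: "?s \<in> carrier M" using assms(3,4) by (intro M.finsum_closed) (auto simp: Pi_iff)
  have vi: "v i \<in> carrier M" and ci: "c i \<in> carrier K" using assms by auto
  have "c i \<odot>\<^bsub>M\<^esub> v i \<oplus>\<^bsub>M\<^esub> ?s = \<zero>\<^bsub>M\<^esub>"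
    using rel assms(1-4) by (subst (asm) M.finsum_insert) (auto simp: Pi_iff)
  then have eq: "c i \<odot>\<^bsub>M\<^esub> v i = \<ominus>\<^bsub>M\<^esub> ?s"
    using vi ci sM by (metis M.minus_equality smult_closed)
  \<comment> \<open>The relation gives \<open>v i\<close> times \<open>c i\<close> as minus the
    remaining sum; acting with a right inverse of \<open>c i\<close> isolates
    \<open>v i\<close>.\<close>
  obtain d where d: "d \<in> carrier K" "c i \<otimes>\<^bsub>K\<^esub> d = \<one>\<^bsub>K\<^esub>"
    using right_inverse[OF ci] assms(5) by blast
  have "v i = d \<odot>\<^bsub>M\<^esub> (\<ominus>\<^bsub>M\<^esub> ?s)"
    unfolding eq[symmetric] using smult_assoc[OF ci d(1) vi] d vi by simp
  then show ?thesis
    using span_smult[OF assms(1) _ span_minus[OF assms(1) _ s] d(1)] assms(3) by auto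
qed

text \<open>Puts linear dependence into the shape of \<open>F_independent\<close>, where one element
  is tested against the others. Over a division ring any index with nonzero coefficient can be
  solved for.\<close>

lemma dependent_iff:
  assumes "finite I" "v \<in> I \<rightarrow> carrier M"
  shows "lin_dependent K M I v \<longleftrightarrow> (\<exists>i\<in>I. v i \<in> lin_span K M (I - {i}) v)"
proof
  assume "lin_dependent K M I v"
  then obtain c i where c: "c \<in> I \<rightarrow> carrier K" "i \<in> I" "c i \<noteq> \<zero>\<^bsub>K\<^esub>"
    "(\<Oplus>\<^bsub>M\<^esub>i\<in>I. c i \<odot>\<^bsub>M\<^esub> v i) = \<zero>\<^bsub>M\<^esub>"
    by (auto simp: lin_dependent_def)
  then have "v i \<in> lin_span K M (I - {i}) v"
    using assms by (intro span_of_relation[of _ _ _ c]) (auto simp: insert_absorb)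
  then show "\<exists>i\<in>I. v i \<in> lin_span K M (I - {i}) v" using c(2) by blast
next
  assume "\<exists>i\<in>I. v i \<in> lin_span K M (I - {i}) v"
  then obtain i where i: "i \<in> I" "v i \<in> lin_span K M (I - {i}) v" by blast
  then obtain c where c: "c \<in> I - {i} \<rightarrow> carrier K" "v i = (\<Oplus>\<^bsub>M\<^esub>k\<in>I - {i}. c k \<odot>\<^bsub>M\<^esub> v k)"
    by (elim span_E)
  \<comment> \<open>The coefficient -1 at \<open>i\<close> turns the expression of
    \<open>v i\<close> through the others into a nontrivial relation.\<close>
  define d where "d = c(i := \<ominus>\<^bsub>K\<^esub> \<one>\<^bsub>K\<^esub>)"
  have "(\<Oplus>\<^bsub>M\<^esub>k\<in>I - {i}. d k \<odot>\<^bsub>M\<^esub> v k) = v i"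
    unfolding c(2) using assms c(1) by (intro M.finsum_cong') (auto simp: d_def Pi_iff)
  moreover have "(\<Oplus>\<^bsub>M\<^esub>k\<in>insert i (I - {i}). d k \<odot>\<^bsub>M\<^esub> v k) =
      d i \<odot>\<^bsub>M\<^esub> v i \<oplus>\<^bsub>M\<^esub> (\<Oplus>\<^bsub>M\<^esub>k\<in>I - {i}. d k \<odot>\<^bsub>M\<^esub> v k)"
    using assms c(1) i(1) by (intro M.finsum_insert) (auto simp: d_def Pi_iff)
  moreover have "v i \<in> carrier M" using assms i by auto
  ultimately have "(\<Oplus>\<^bsub>M\<^esub>k\<in>I. d k \<odot>\<^bsub>M\<^esub> v k) = \<zero>\<^bsub>M\<^esub>"
    using i(1) by (simp add: insert_absorb d_def smult_minus_left M.l_neg)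
  moreover have "d i \<noteq> \<zero>\<^bsub>K\<^esub>"
    using one_neq_zero by (simp add: d_def) 
  ultimately show "lin_dependent K M I v"
    unfolding lin_dependent_def using c(1) i(1)
    by (intro exI[of _ d]) (auto simp: d_def)
qed

text \<open>A relation with nonzero coefficient at \<open>i\<close> would put \<open>v i\<close>
  into the span, so that coefficient vanishes and a nontrivial relation on \<open>I\<close> remains.
  This is what lets a maximal independent family span.\<close>

lemma independent_insert:
  assumes "finite I" "i \<notin> I" "v \<in> insert i I \<rightarrow> carrier M"
    and "\<not> lin_dependent K M I v" "v i \<notin> lin_span K M I v"
  shows "\<not> lin_dependent K M (insert i I) v"
proof
  assume "lin_dependent K M (insert i I) v"
  then obtain c j where c: "c \<in> insert i I \<rightarrow> carrier K" "j \<in> insert i I" "c j \<noteq> \<zero>\<^bsub>K\<^esub>"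
    "(\<Oplus>\<^bsub>M\<^esub>k\<in>insert i I. c k \<odot>\<^bsub>M\<^esub> v k) = \<zero>\<^bsub>M\<^esub>"
    unfolding lin_dependent_def by blast
  have ci: "c i = \<zero>\<^bsub>K\<^esub>"
    using span_of_relation[OF assms(1-3) c(1) _ c(4)] assms(5) by blast
  have "c i \<odot>\<^bsub>M\<^esub> v i \<oplus>\<^bsub>M\<^esub> (\<Oplus>\<^bsub>M\<^esub>k\<in>I. c k \<odot>\<^bsub>M\<^esub> v k) = \<zero>\<^bsub>M\<^esub>"
    using c(1,4) assms(1-3) by (subst (asm) M.finsum_insert) (auto simp: Pi_iff)
  moreover have "(\<Oplus>\<^bsub>M\<^esub>k\<in>I. c k \<odot>\<^bsub>M\<^esub> v k) \<in> carrier M"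
    using assms(3) c(1) by (intro M.finsum_closed) (auto simp: Pi_iff)
  ultimately have "(\<Oplus>\<^bsub>M\<^esub>k\<in>I. c k \<odot>\<^bsub>M\<^esub> v k) = \<zero>\<^bsub>M\<^esub>" using assms(3) ci by auto
  then show False
    using assms(4) c(1-3) ci unfolding lin_dependent_def by auto
qed

text \<open>One step of Gaussian elimination with pivot \<open>v i0\<close>: a relation among the
  reduced vectors expands to one among the original vectors with the same coefficients away from
  \<open>i0\<close>. It drives both the exchange bound and the induction over the factors of
  f.\<close>

lemma independent_eliminate:
  assumes fin: "finite I" and v: "v \<in> I \<rightarrow> carrier M" and i0: "i0 \<in> I" and c: "c \<in> I \<rightarrow> carrier K"
    and indep: "\<not> lin_dependent K M I v"
  shows "\<not> lin_dependent K M (I - {i0}) (\<lambda>i. v i \<ominus>\<^bsub>M\<^esub> c i \<odot>\<^bsub>M\<^esub> v i0)"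
proof
  let ?J = "I - {i0}"
  assume "lin_dependent K M ?J (\<lambda>i. v i \<ominus>\<^bsub>M\<^esub> c i \<odot>\<^bsub>M\<^esub> v i0)"
  then obtain d j where d: "d \<in> ?J \<rightarrow> carrier K" "j \<in> ?J" "d j \<noteq> \<zero>\<^bsub>K\<^esub>"
    "(\<Oplus>\<^bsub>M\<^esub>i\<in>?J. d i \<odot>\<^bsub>M\<^esub> (v i \<ominus>\<^bsub>M\<^esub> c i \<odot>\<^bsub>M\<^esub> v i0)) = \<zero>\<^bsub>M\<^esub>"
    unfolding lin_dependent_def by blast
  \<comment> \<open>The coefficient that \<open>v i0\<close> collects on expansion; subtracting
    (\<open>v i0\<close> \<open>c i\<close>) \<open>d i\<close> = \<open>v i0\<close>
    (\<open>c i\<close> \<open>d i\<close>) fixes the order of the product.\<close>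
  define s where "s = (\<Oplus>\<^bsub>K\<^esub>i\<in>?J. \<ominus>\<^bsub>K\<^esub> (c i \<otimes>\<^bsub>K\<^esub> d i))"
  define e where "e = d(i0 := s)"
  have v0: "v i0 \<in> carrier M" using v i0 by auto
  have s: "s \<in> carrier K" unfolding s_def using c d(1) by (intro K.finsum_closed) (auto simp: Pi_iff)
  have "\<zero>\<^bsub>M\<^esub> = (\<Oplus>\<^bsub>M\<^esub>i\<in>?J. d i \<odot>\<^bsub>M\<^esub> v i \<oplus>\<^bsub>M\<^esub> (\<ominus>\<^bsub>K\<^esub> (c i \<otimes>\<^bsub>K\<^esub> d i)) \<odot>\<^bsub>M\<^esub> v i0)"
    unfolding d(4)[symmetric] using v v0 c d(1)
    by (intro M.finsum_cong')
      (auto simp: Pi_iff M.minus_eq smult_r_distr smult_minus_left smult_minus_right smult_assoc)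
  also have "\<dots> = (\<Oplus>\<^bsub>M\<^esub>i\<in>?J. d i \<odot>\<^bsub>M\<^esub> v i) \<oplus>\<^bsub>M\<^esub>
      (\<Oplus>\<^bsub>M\<^esub>i\<in>?J. (\<ominus>\<^bsub>K\<^esub> (c i \<otimes>\<^bsub>K\<^esub> d i)) \<odot>\<^bsub>M\<^esub> v i0)"
    using v v0 c d(1) by (intro M.finsum_addf) (auto simp: Pi_iff)
  also have "(\<Oplus>\<^bsub>M\<^esub>i\<in>?J. (\<ominus>\<^bsub>K\<^esub> (c i \<otimes>\<^bsub>K\<^esub> d i)) \<odot>\<^bsub>M\<^esub> v i0) = s \<odot>\<^bsub>M\<^esub> v i0"
    unfolding s_def using fin v0 c d(1) by (intro finsum_smult_left[symmetric]) (auto simp: Pi_iff)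
  also have "(\<Oplus>\<^bsub>M\<^esub>i\<in>?J. d i \<odot>\<^bsub>M\<^esub> v i) = (\<Oplus>\<^bsub>M\<^esub>i\<in>?J. e i \<odot>\<^bsub>M\<^esub> v i)"
    unfolding e_def using v d(1) by (intro M.finsum_cong') (auto simp: Pi_iff)
  finally have "(\<Oplus>\<^bsub>M\<^esub>i\<in>?J. e i \<odot>\<^bsub>M\<^esub> v i) \<oplus>\<^bsub>M\<^esub> s \<odot>\<^bsub>M\<^esub> v i0 = \<zero>\<^bsub>M\<^esub>" by simp
  moreover have "(\<Oplus>\<^bsub>M\<^esub>i\<in>?J. e i \<odot>\<^bsub>M\<^esub> v i) \<in> carrier M"
    using v d(1) by (intro M.finsum_closed) (auto simp: Pi_iff e_def)
  moreover have "(\<Oplus>\<^bsub>M\<^esub>i\<in>insert i0 ?J. e i \<odot>\<^bsub>M\<^esub> v i) =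
      e i0 \<odot>\<^bsub>M\<^esub> v i0 \<oplus>\<^bsub>M\<^esub> (\<Oplus>\<^bsub>M\<^esub>i\<in>?J. e i \<odot>\<^bsub>M\<^esub> v i)"
    using fin v d(1) s v0 by (intro M.finsum_insert) (auto simp: Pi_iff e_def)
  ultimately have "(\<Oplus>\<^bsub>M\<^esub>i\<in>I. e i \<odot>\<^bsub>M\<^esub> v i) = \<zero>\<^bsub>M\<^esub>"
    using i0 s v0 by (simp add: insert_absorb e_def M.a_comm)
  moreover have "e \<in> I \<rightarrow> carrier K" using d(1) s by (auto simp: e_def)
  moreover have "e j \<noteq> \<zero>\<^bsub>K\<^esub>" using d(2,3) by (auto simp: e_def)
  ultimately show False using indep d(2) unfolding lin_dependent_def by blast
qed

text \<open>The Steinitz bound, by induction on the spanning family. If some \<open>w i0\<close> has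
  a nonzero coefficient at the new index \<open>j\<close>, it serves as pivot to clear
  \<open>u j\<close> from all other \<open>w i\<close>; these stay independent and lie in the
  smaller span.\<close>

lemma card_independent_le:
  assumes "finite J" "u \<in> J \<rightarrow> carrier M" "finite I" "\<And>i. i \<in> I \<Longrightarrow> w i \<in> lin_span K M J u"
    and "\<not> lin_dependent K M I w"
  shows "card I \<le> card J"
  using assms
proof (induction J arbitrary: I w rule: finite_induct)
  case empty
  have "I = {}"
  proof (rule ccontr)
    assume "I \<noteq> {}"
    then obtain i where i: "i \<in> I" by blast
    have w: "w i = \<zero>\<^bsub>M\<^esub>" if "i \<in> I" for i using empty(3)[OF that] by simp
    then have "w i \<in> lin_span K M (I - {i}) w" using i span_zero[of w "I - {i}"] by auto
    then show False using dependent_iff[of I w] empty i w by auto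
  qed
  then show ?case by simp
next
  case (insert j J)
  have u: "u \<in> J \<rightarrow> carrier M" and uj: "u j \<in> carrier M" using insert.prems by auto
  have "\<exists>a y. a \<in> carrier K \<and> y \<in> lin_span K M J u \<and> w i = a \<odot>\<^bsub>M\<^esub> u j \<oplus>\<^bsub>M\<^esub> y" if "i \<in> I" for i
    using span_insert_E[OF insert(1,2) insert(4) insert(6)[OF that]] by metis
  then obtain a y where ay: "\<And>i. i \<in> I \<Longrightarrow> a i \<in> carrier K"
    "\<And>i. i \<in> I \<Longrightarrow> y i \<in> lin_span K M J u" "\<And>i. i \<in> I \<Longrightarrow> w i = a i \<odot>\<^bsub>M\<^esub> u j \<oplus>\<^bsub>M\<^esub> y i"
    by metis
  have yM: "y i \<in> carrier M" if "i \<in> I" for i using span_closed[OF u ay(2)[OF that]] .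
  have wM: "w \<in> I \<rightarrow> carrier M" using ay yM uj by auto
  show ?case
  proof (cases "\<forall>i\<in>I. a i = \<zero>\<^bsub>K\<^esub>")
    case True
    then have "w i \<in> lin_span K M J u" if "i \<in> I" for i
      using ay(2,3)[OF that] yM[OF that] uj that by simp
    then have "card I \<le> card J" using insert.IH[OF u insert(5) _ insert(7)] by blast
    then show ?thesis using insert(1,2) by simp
  next
    case False
    then obtain i0 where i0: "i0 \<in> I" "a i0 \<noteq> \<zero>\<^bsub>K\<^esub>" by blast
    obtain b where b: "b \<in> carrier K" "a i0 \<otimes>\<^bsub>K\<^esub> b = \<one>\<^bsub>K\<^esub>"
      using right_inverse[OF ay(1)[OF i0(1)] i0(2)] by blast
    \<comment> \<open>With \<open>b\<close> a right inverse of \<open>a i0\<close>, the product of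
      \<open>a i0\<close> and \<open>?c i\<close> is \<open>a i\<close>, so subtracting
      \<open>w i0\<close> times \<open>?c i\<close> cancels exactly the \<open>u j\<close> part of
      \<open>w i\<close>.\<close>
    let ?c = "\<lambda>i. b \<otimes>\<^bsub>K\<^esub> a i"
    have c: "?c \<in> I \<rightarrow> carrier K" using b ay by auto
    have "w i \<ominus>\<^bsub>M\<^esub> ?c i \<odot>\<^bsub>M\<^esub> w i0 \<in> lin_span K M J u" if i: "i \<in> I - {i0}" for i
    proof -
      have iI: "i \<in> I" using i by simp
      note cl = ay(1)[OF iI] ay(1)[OF i0(1)] yM[OF iI] yM[OF i0(1)] uj b(1)
      have "a i0 \<otimes>\<^bsub>K\<^esub> ?c i = a i"
        using cl b(2) by (simp add: K.m_assoc[symmetric])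
      then have "?c i \<odot>\<^bsub>M\<^esub> w i0 = a i \<odot>\<^bsub>M\<^esub> u j \<oplus>\<^bsub>M\<^esub> ?c i \<odot>\<^bsub>M\<^esub> y i0"
        unfolding ay(3)[OF i0(1)] using cl by (simp add: smult_r_distr smult_assoc)
      then have "w i \<ominus>\<^bsub>M\<^esub> ?c i \<odot>\<^bsub>M\<^esub> w i0 = y i \<oplus>\<^bsub>M\<^esub> \<ominus>\<^bsub>M\<^esub> (?c i \<odot>\<^bsub>M\<^esub> y i0)"
        unfolding ay(3)[OF iI] using cl
        by (simp add: M.minus_eq M.minus_add M.a_ac M.r_neg1 M.r_neg2)
      then show ?thesis
        using span_add[OF u ay(2)[OF iI] span_minus[OF insert(1) u span_smult[OF insert(1) u ay(2)[OF i0(1)]]]]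
          c iI by (auto simp: Pi_iff)
    qed
    then have "card (I - {i0}) \<le> card J"
      using insert.IH[OF u _ _ independent_eliminate[OF insert(5) wM i0(1) c insert(7)]] insert(5)
      by blast
    then show ?thesis using insert(1,2,5) i0(1) by simp
  qed
qed

section \<open>From families to sets of vectors, and dimension\<close>

lemma dependent_reindex:
  assumes "inj_on v I" "v \<in> I \<rightarrow> carrier M"
  shows "lin_dependent K M (v ` I) (\<lambda>x. x) \<longleftrightarrow> lin_dependent K M I v"
proof
  assume "lin_dependent K M (v ` I) (\<lambda>x. x)"
  then obtain c i where c: "c \<in> v ` I \<rightarrow> carrier K" "i \<in> I" "c (v i) \<noteq> \<zero>\<^bsub>K\<^esub>"
    "(\<Oplus>\<^bsub>M\<^esub>x\<in>v ` I. c x \<odot>\<^bsub>M\<^esub> x) = \<zero>\<^bsub>M\<^esub>"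
    unfolding lin_dependent_def by blast
  then have "(\<Oplus>\<^bsub>M\<^esub>i\<in>I. c (v i) \<odot>\<^bsub>M\<^esub> v i) = \<zero>\<^bsub>M\<^esub>"
    using assms by (subst (asm) M.finsum_reindex) (auto simp: Pi_iff)
  then show "lin_dependent K M I v"
    unfolding lin_dependent_def using c by (intro exI[of _ "\<lambda>i. c (v i)"]) auto
next
  assume "lin_dependent K M I v"
  then obtain c i where c: "c \<in> I \<rightarrow> carrier K" "i \<in> I" "c i \<noteq> \<zero>\<^bsub>K\<^esub>"
    "(\<Oplus>\<^bsub>M\<^esub>x\<in>I. c x \<odot>\<^bsub>M\<^esub> v x) = \<zero>\<^bsub>M\<^esub>"
    unfolding lin_dependent_def by blast
  \<comment> \<open>Injectivity of \<open>v\<close> allows each coefficient to be carried from an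
    index to its vector.\<close>
  let ?d = "\<lambda>x. c (inv_into I v x)"
  have "(\<Oplus>\<^bsub>M\<^esub>x\<in>v ` I. ?d x \<odot>\<^bsub>M\<^esub> x) = (\<Oplus>\<^bsub>M\<^esub>x\<in>I. ?d (v x) \<odot>\<^bsub>M\<^esub> v x)"
    using assms c(1) by (subst M.finsum_reindex) (auto simp: Pi_iff)
  also have "\<dots> = (\<Oplus>\<^bsub>M\<^esub>x\<in>I. c x \<odot>\<^bsub>M\<^esub> v x)"
    using assms c(1) by (intro M.finsum_cong') (auto simp: Pi_iff)
  finally show "lin_dependent K M (v ` I) (\<lambda>x. x)"
    unfolding lin_dependent_def using c assms(1)
    by (intro exI[of _ ?d]) (auto simp: Pi_iff)
qed

lemma span_reindex:
  assumes "inj_on v I" "v \<in> I \<rightarrow> carrier M"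
  shows "lin_span K M I v \<subseteq> lin_span K M (v ` I) (\<lambda>x. x)"
proof
  fix x assume "x \<in> lin_span K M I v"
  then obtain c where c: "c \<in> I \<rightarrow> carrier K" "x = (\<Oplus>\<^bsub>M\<^esub>i\<in>I. c i \<odot>\<^bsub>M\<^esub> v i)"
    by (rule span_E)
  let ?d = "\<lambda>x. c (inv_into I v x)"
  have "(\<Oplus>\<^bsub>M\<^esub>x\<in>v ` I. ?d x \<odot>\<^bsub>M\<^esub> x) = (\<Oplus>\<^bsub>M\<^esub>x\<in>I. ?d (v x) \<odot>\<^bsub>M\<^esub> v x)"
    using assms c(1) by (subst M.finsum_reindex) (auto simp: Pi_iff)
  also have "\<dots> = x"
    unfolding c(2) using assms c(1) by (intro M.finsum_cong') (auto simp: Pi_iff)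
  finally show "x \<in> lin_span K M (v ` I) (\<lambda>x. x)"
    using c(1) assms(1) by (intro span_I[of ?d]) (auto simp: Pi_iff)
qed

text \<open>A vector that occurs at two indices lies in the span of its other occurrence.\<close>

lemma independent_inj_on:
  assumes "finite I" "v \<in> I \<rightarrow> carrier M" "\<not> lin_dependent K M I v"
  shows "inj_on v I"
proof (rule inj_onI, rule ccontr)
  fix i j assume ij: "i \<in> I" "j \<in> I" "v i = v j" "i \<noteq> j"
  then have "v i \<in> lin_span K M (I - {i}) v"
    using span_member[of "I - {i}" v j] assms by (auto simp: Pi_iff)
  then show False using dependent_iff[OF assms(1,2)] assms(3) ij(1) by blast
qed

lemma lin_dim_eq_card:
  assumes fin: "finite I" and v: "v \<in> I \<rightarrow> carrier M" and indep: "\<not> lin_dependent K M I v"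
    and span: "carrier M \<subseteq> lin_span K M I v"
  shows "lin_dim K M = enat (card I)"
proof -
  have inj: "inj_on v I" by (rule independent_inj_on[OF fin v indep])
  have sub: "v ` I \<subseteq> carrier M" using v by auto
  have "lin_basis K M (v ` I)"
    unfolding lin_basis_def
  proof (intro conjI sub allI impI ballI)
    fix A assume A: "finite A \<and> A \<subseteq> v ` I"
    show "\<not> lin_dependent K M A (\<lambda>v. v)"
    proof
      assume "lin_dependent K M A (\<lambda>v. v)"
      then obtain x where x: "x \<in> A" "x \<in> lin_span K M (A - {x}) (\<lambda>x. x)"
        using dependent_iff[of A "\<lambda>x. x"] A sub by (auto simp: Pi_iff subset_iff)
      then have "x \<in> lin_span K M (v ` I - {x}) (\<lambda>x. x)"
        using span_mono[of "v ` I - {x}" "A - {x}" "\<lambda>x. x"] A sub fin by auto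
      then have "lin_dependent K M (v ` I) (\<lambda>x. x)"
        using dependent_iff[of "v ` I" "\<lambda>x. x"] x(1) A sub fin by (simp add: Pi_iff subset_iff) blast
      then show False using dependent_reindex[OF inj v] indep by blast
    qed
  next
    fix x assume "x \<in> carrier M"
    then have "x \<in> lin_span K M (v ` I) (\<lambda>x. x)" using span span_reindex[OF inj v] by blast
    then obtain c where "c \<in> v ` I \<rightarrow> carrier K" "x = (\<Oplus>\<^bsub>M\<^esub>v\<in>v ` I. c v \<odot>\<^bsub>M\<^esub> v)"
      by (rule span_E)
    then show "\<exists>A c. finite A \<and> A \<subseteq> v ` I \<and> c \<in> A \<rightarrow> carrier K \<and> x = (\<Oplus>\<^bsub>M\<^esub>v\<in>A. c v \<odot>\<^bsub>M\<^esub> v)"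
      using fin by blast
  qed
  moreover have "ecard (v ` I) = enat (card I)"
    using fin inj by (simp add: ecard_def card_image)
  moreover have "ecard B = enat (card I)" if B: "lin_basis K M B" for B
  proof -
    have BM: "B \<subseteq> carrier M" using B by (simp add: lin_basis_def)
    have le: "card A \<le> card I" if "finite A" "A \<subseteq> B" for A
    proof (rule card_independent_le[OF fin v that(1)])
      show "x \<in> lin_span K M I v" if "x \<in> A" for x using that \<open>A \<subseteq> B\<close> BM span by blast
      show "\<not> lin_dependent K M A (\<lambda>x. x)" using B that unfolding lin_basis_def by simp
    qed
    \<comment> \<open>An infinite \<open>B\<close> would have a finite subset with one element more
      than \<open>I\<close>, contradicting \<open>le\<close>.\<close>
    have finB: "finite B"
      using infinite_arbitrarily_large[of B "Suc (card I)"] le by (metis not_less_eq_eq order_refl)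
    have "v i \<in> lin_span K M B (\<lambda>x. x)" if i: "i \<in> I" for i
    proof -
      obtain A c where A: "A \<subseteq> B" "c \<in> A \<rightarrow> carrier K" "v i = (\<Oplus>\<^bsub>M\<^esub>v\<in>A. c v \<odot>\<^bsub>M\<^esub> v)"
        using B funcset_mem[OF v i] unfolding lin_basis_def by metis
      then have "v i \<in> lin_span K M A (\<lambda>x. x)" by (intro span_I)
      then show ?thesis using span_mono[OF finB A(1), of "\<lambda>x. x"] BM by blast
    qed
    then have "card I \<le> card B"
      using card_independent_le[OF finB _ fin _ indep, of "\<lambda>x. x"] BM by blast
    then show ?thesis using le[OF finB] finB by (simp add: ecard_def)
  qed
  ultimately show ?thesis unfolding lin_dim_def by (intro the_equality) metis+
qed

section \<open>Subspaces, encoded as the same structure with a smaller carrier\<close>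

lemma finsum_subspace:
  assumes W: "W \<subseteq> carrier M" "abelian_group (M\<lparr>carrier := W\<rparr>)" and "finite I" "v \<in> I \<rightarrow> W"
  shows "(\<Oplus>\<^bsub>M\<lparr>carrier := W\<rparr>\<^esub>i\<in>I. v i) = (\<Oplus>\<^bsub>M\<^esub>i\<in>I. v i)"
proof -
  interpret W: abelian_group "M\<lparr>carrier := W\<rparr>" by fact
  show ?thesis using assms(3,4)
  proof (induction I rule: finite_induct)
    case empty
    then show ?case by simp
  next
    case (insert i I)
    then have "v \<in> I \<rightarrow> carrier M" "v i \<in> carrier M" using W(1) by auto
    then show ?case using insert by (simp add: W.finsum_insert M.finsum_insert)
  qed
qed

text \<open>Closure under negation comes for free, since the negative of a vector is its multiple by
  -1.\<close>

lemma subspace: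
  assumes W: "W \<subseteq> carrier M" "\<zero>\<^bsub>M\<^esub> \<in> W" "\<And>x y. \<lbrakk>x \<in> W; y \<in> W\<rbrakk> \<Longrightarrow> x \<oplus>\<^bsub>M\<^esub> y \<in> W"
    "\<And>c x. \<lbrakk>c \<in> carrier K; x \<in> W\<rbrakk> \<Longrightarrow> c \<odot>\<^bsub>M\<^esub> x \<in> W"
  shows "right_vector_space K (M\<lparr>carrier := W\<rparr>)"
proof -
  have minus: "\<ominus>\<^bsub>M\<^esub> x \<in> W" if "x \<in> W" for x
    using W(4)[of "\<ominus>\<^bsub>K\<^esub> \<one>\<^bsub>K\<^esub>" x] that W(1) smult_minus_left[of "\<one>\<^bsub>K\<^esub>" x] by auto
  have "abelian_group (M\<lparr>carrier := W\<rparr>)"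
    using W(1-3) minus
    by (intro abelian_groupI)
      (auto simp: M.a_assoc subset_iff M.a_comm[of _ "\<zero>\<^bsub>M\<^esub>"] intro!: M.a_comm bexI[of _ "\<ominus>\<^bsub>M\<^esub> _"] M.l_neg)
  then interpret W: abelian_group "M\<lparr>carrier := W\<rparr>" .
  show ?thesis
    by unfold_locales
      (use W in \<open>auto simp: subset_iff smult_r_distr smult_l_distr smult_assoc one_neq_zero right_inverse\<close>)
qed

lemma dependent_subspace:
  assumes "right_vector_space K (M\<lparr>carrier := W\<rparr>)" "W \<subseteq> carrier M" "finite I" "v \<in> I \<rightarrow> W"
  shows "lin_dependent K (M\<lparr>carrier := W\<rparr>) I v \<longleftrightarrow> lin_dependent K M I v"
proof -
  interpret W: right_vector_space K "M\<lparr>carrier := W\<rparr>" by fact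
  have "(\<Oplus>\<^bsub>M\<lparr>carrier := W\<rparr>\<^esub>i\<in>I. c i \<odot>\<^bsub>M\<^esub> v i) = (\<Oplus>\<^bsub>M\<^esub>i\<in>I. c i \<odot>\<^bsub>M\<^esub> v i)" if "c \<in> I \<rightarrow> carrier K" for c
    using that assms W.smult_closed
    by (intro finsum_subspace W.M.abelian_group_axioms) (auto simp: Pi_iff)
  then show ?thesis unfolding lin_dependent_def by auto
qed

lemma span_subspace:
  assumes "right_vector_space K (M\<lparr>carrier := W\<rparr>)" "W \<subseteq> carrier M" "finite I" "v \<in> I \<rightarrow> W"
  shows "lin_span K (M\<lparr>carrier := W\<rparr>) I v = lin_span K M I v"
proof -
  interpret W: right_vector_space K "M\<lparr>carrier := W\<rparr>" by fact
  have "(\<Oplus>\<^bsub>M\<lparr>carrier := W\<rparr>\<^esub>i\<in>I. c i \<odot>\<^bsub>M\<^esub> v i) = (\<Oplus>\<^bsub>M\<^esub>i\<in>I. c i \<odot>\<^bsub>M\<^esub> v i)" if "c \<in> I \<rightarrow> carrier K" for c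
    using that assms W.smult_closed
    by (intro finsum_subspace W.M.abelian_group_axioms) (auto simp: Pi_iff)
  then show ?thesis unfolding lin_span_def by (intro Collect_cong ex_cong1) auto
qed

end

section \<open>Quotients by principal left ideals and their endomorphisms\<close>

context ring
begin

lemma left_ideal_gen_iff: "x \<in> left_ideal_gen R a \<longleftrightarrow> (\<exists>r\<in>carrier R. x = r \<otimes> a)"
  by (auto simp: left_ideal_gen_def)

lemma left_ideal_gen_subset: "a \<in> carrier R \<Longrightarrow> left_ideal_gen R a \<subseteq> carrier R"
  by (auto simp: left_ideal_gen_def)

lemma left_ideal_gen_mult:
  "\<lbrakk>a \<in> carrier R; x \<in> left_ideal_gen R a; r \<in> carrier R\<rbrakk> \<Longrightarrow> r \<otimes> x \<in> left_ideal_gen R a"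
  unfolding left_ideal_gen_iff by (metis m_assoc m_closed)

lemma left_ideal_gen_self: "a \<in> carrier R \<Longrightarrow> a \<in> left_ideal_gen R a"
  unfolding left_ideal_gen_iff by (metis l_one one_closed)

lemma left_ideal_gen_subgroup:
  assumes a: "a \<in> carrier R"
  shows "abelian_subgroup (left_ideal_gen R a) R"
proof -
  have "subgroup (left_ideal_gen R a) (add_monoid R)"
  proof (rule add.subgroupI)
    show "left_ideal_gen R a \<subseteq> carrier R" by (rule left_ideal_gen_subset[OF a])
    show "left_ideal_gen R a \<noteq> {}" using left_ideal_gen_self[OF a] by blast
    show "\<ominus> u \<in> left_ideal_gen R a" if "u \<in> left_ideal_gen R a" for u
      using that a unfolding left_ideal_gen_iff by (metis a_inv_closed l_minus)
    show "u \<oplus> v \<in> left_ideal_gen R a" if "u \<in> left_ideal_gen R a" "v \<in> left_ideal_gen R a" for u v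
      using that a unfolding left_ideal_gen_iff by (metis a_closed l_distr)
  qed
  then show ?thesis
    by (intro abelian_subgroupI3) (simp_all add: additive_subgroup_def abelian_group_axioms)
qed

lemma quot_module_simps:
  "carrier (quot_module R a) = a_rcosets (left_ideal_gen R a)"
  "\<zero>\<^bsub>quot_module R a\<^esub> = left_ideal_gen R a"
  "X \<oplus>\<^bsub>quot_module R a\<^esub> Y = X <+> Y"
  by (simp_all add: quot_module_def)

lemma quot_module_abelian_group:
  assumes "a \<in> carrier R"
  shows "abelian_group (quot_module R a)"
proof -
  interpret I: abelian_subgroup "left_ideal_gen R a" R by (rule left_ideal_gen_subgroup[OF assms])
  interpret G: comm_group "R A_Mod (left_ideal_gen R a)" by (rule I.a_factorgroup_is_comm_group)
  show ?thesis
    by (intro abelian_groupI)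
      (use G.m_closed G.one_closed G.m_assoc G.m_comm G.l_one G.l_inv_ex
        in \<open>auto simp: quot_module_simps A_FactGroup_def'\<close>)
qed

lemma quot_module_carrier:
  "m \<in> carrier (quot_module R a) \<longleftrightarrow> (\<exists>x\<in>carrier R. m = left_ideal_gen R a +> x)"
  by (auto simp: quot_module_simps A_RCOSETS_def')

lemma quot_module_zero_iff:
  assumes "a \<in> carrier R" "x \<in> carrier R"
  shows "left_ideal_gen R a +> x = \<zero>\<^bsub>quot_module R a\<^esub> \<longleftrightarrow> x \<in> left_ideal_gen R a"
proof -
  interpret I: abelian_subgroup "left_ideal_gen R a" R by (rule left_ideal_gen_subgroup[OF assms(1)])
  show ?thesis
    unfolding quot_module_simps
    using I.a_rcos_self[OF assms(2)] I.a_rcos_const by metis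
qed

lemma quot_module_add:
  assumes "a \<in> carrier R" "x \<in> carrier R" "y \<in> carrier R"
  shows "(left_ideal_gen R a +> x) \<oplus>\<^bsub>quot_module R a\<^esub> (left_ideal_gen R a +> y) =
    left_ideal_gen R a +> (x \<oplus> y)"
proof -
  interpret I: abelian_subgroup "left_ideal_gen R a" R by (rule left_ideal_gen_subgroup[OF assms(1)])
  show ?thesis unfolding quot_module_simps using assms(2,3) by (rule I.a_rcos_sum)
qed

lemmas quot_smult = quot_module_smult[OF ring_axioms]

end

locale quot = ring R for R (structure) and a +
  assumes gen_closed: "a \<in> carrier R"
begin

abbreviation "Q \<equiv> quot_module R a"

sublocale Q: abelian_group Q
  by (rule quot_module_abelian_group[OF gen_closed])

lemma smult_closed [simp, intro]:
  "\<lbrakk>r \<in> carrier R; m \<in> carrier Q\<rbrakk> \<Longrightarrow> r \<odot>\<^bsub>Q\<^esub> m \<in> carrier Q"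
  unfolding quot_module_carrier using quot_smult[OF gen_closed] by (metis m_closed)

lemma smult_r_distr:
  assumes "r \<in> carrier R" "m \<in> carrier Q" "n \<in> carrier Q"
  shows "r \<odot>\<^bsub>Q\<^esub> (m \<oplus>\<^bsub>Q\<^esub> n) = r \<odot>\<^bsub>Q\<^esub> m \<oplus>\<^bsub>Q\<^esub> r \<odot>\<^bsub>Q\<^esub> n"
proof -
  obtain x y where xy: "x \<in> carrier R" "m = left_ideal_gen R a +> x" "y \<in> carrier R" "n = left_ideal_gen R a +> y"
    using assms unfolding quot_module_carrier by blast
  then show ?thesis
    using assms(1) gen_closed by (simp add: quot_module_add quot_smult r_distr)
qed

lemma smult_l_distr:
  assumes "r \<in> carrier R" "s \<in> carrier R" "m \<in> carrier Q"
  shows "(r \<oplus> s) \<odot>\<^bsub>Q\<^esub> m = r \<odot>\<^bsub>Q\<^esub> m \<oplus>\<^bsub>Q\<^esub> s \<odot>\<^bsub>Q\<^esub> m"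
proof -
  obtain x where x: "x \<in> carrier R" "m = left_ideal_gen R a +> x"
    using assms unfolding quot_module_carrier by blast
  then show ?thesis
    using assms(1,2) gen_closed by (simp add: quot_module_add quot_smult l_distr)
qed

lemma smult_assoc:
  assumes "r \<in> carrier R" "s \<in> carrier R" "m \<in> carrier Q"
  shows "(r \<otimes> s) \<odot>\<^bsub>Q\<^esub> m = r \<odot>\<^bsub>Q\<^esub> (s \<odot>\<^bsub>Q\<^esub> m)"
proof -
  obtain x where x: "x \<in> carrier R" "m = left_ideal_gen R a +> x"
    using assms unfolding quot_module_carrier by blast
  then show ?thesis
    using assms(1,2) gen_closed by (simp add: quot_smult m_assoc)
qed

lemma smult_one [simp]:
  assumes "m \<in> carrier Q"
  shows "\<one> \<odot>\<^bsub>Q\<^esub> m = m"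
  using assms gen_closed unfolding quot_module_carrier by (auto simp: quot_smult)

lemma smult_zero_right [simp]: "r \<in> carrier R \<Longrightarrow> r \<odot>\<^bsub>Q\<^esub> \<zero>\<^bsub>Q\<^esub> = \<zero>\<^bsub>Q\<^esub>"
  using smult_r_distr[of r "\<zero>\<^bsub>Q\<^esub>" "\<zero>\<^bsub>Q\<^esub>"] Q.add.l_cancel_one'[of "r \<odot>\<^bsub>Q\<^esub> \<zero>\<^bsub>Q\<^esub>" "r \<odot>\<^bsub>Q\<^esub> \<zero>\<^bsub>Q\<^esub>"]
  by simp

lemma smult_minus_left:
  assumes "r \<in> carrier R" "m \<in> carrier Q"
  shows "(\<ominus> r) \<odot>\<^bsub>Q\<^esub> m = \<ominus>\<^bsub>Q\<^esub> (r \<odot>\<^bsub>Q\<^esub> m)"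
proof -
  have "\<zero> \<odot>\<^bsub>Q\<^esub> m = \<zero>\<^bsub>Q\<^esub>"
    using smult_l_distr[of \<zero> \<zero> m] Q.add.l_cancel_one'[of "\<zero> \<odot>\<^bsub>Q\<^esub> m" "\<zero> \<odot>\<^bsub>Q\<^esub> m"] assms
    by simp
  then have "(\<ominus> r) \<odot>\<^bsub>Q\<^esub> m \<oplus>\<^bsub>Q\<^esub> r \<odot>\<^bsub>Q\<^esub> m = \<zero>\<^bsub>Q\<^esub>"
    using assms by (simp add: smult_l_distr[symmetric] l_neg)
  then show ?thesis using assms by (intro Q.minus_equality[symmetric]) auto
qed

lemma smult_minus_right:
  assumes "r \<in> carrier R" "m \<in> carrier Q"
  shows "r \<odot>\<^bsub>Q\<^esub> (\<ominus>\<^bsub>Q\<^esub> m) = \<ominus>\<^bsub>Q\<^esub> (r \<odot>\<^bsub>Q\<^esub> m)"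
proof -
  have "r \<odot>\<^bsub>Q\<^esub> (\<ominus>\<^bsub>Q\<^esub> m) \<oplus>\<^bsub>Q\<^esub> r \<odot>\<^bsub>Q\<^esub> m = \<zero>\<^bsub>Q\<^esub>"
    using assms by (simp add: smult_r_distr[symmetric] Q.l_neg)
  then show ?thesis using assms by (intro Q.minus_equality[symmetric]) auto
qed

definition "gen = left_ideal_gen R a +> \<one>"

lemma gen_in [simp, intro]: "gen \<in> carrier Q"
  unfolding gen_def quot_module_carrier by blast

lemma smult_gen: "x \<in> carrier R \<Longrightarrow> x \<odot>\<^bsub>Q\<^esub> gen = left_ideal_gen R a +> x"
  using gen_closed by (simp add: gen_def quot_smult)

lemma gen_generates: "m \<in> carrier Q \<Longrightarrow> \<exists>x\<in>carrier R. m = x \<odot>\<^bsub>Q\<^esub> gen"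
  using smult_gen unfolding quot_module_carrier by metis

lemma smult_gen_zero_iff: "x \<in> carrier R \<Longrightarrow> x \<odot>\<^bsub>Q\<^esub> gen = \<zero>\<^bsub>Q\<^esub> \<longleftrightarrow> x \<in> left_ideal_gen R a"
  using smult_gen quot_module_zero_iff[OF gen_closed] by simp

definition annihilator :: "'a set \<Rightarrow> 'a set" where
  "annihilator m = {r \<in> carrier R. r \<odot>\<^bsub>Q\<^esub> m = \<zero>\<^bsub>Q\<^esub>}"

lemma annihilator_gen: "annihilator gen = left_ideal_gen R a"
  unfolding annihilator_def using smult_gen_zero_iff left_ideal_gen_subset[OF gen_closed] by blast

lemma annihilator_zero: "annihilator \<zero>\<^bsub>Q\<^esub> = carrier R"
  by (auto simp: annihilator_def)

lemma smult_eq_iff: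
  assumes "r \<in> carrier R" "s \<in> carrier R" "m \<in> carrier Q"
  shows "r \<odot>\<^bsub>Q\<^esub> m = s \<odot>\<^bsub>Q\<^esub> m \<longleftrightarrow> r \<ominus> s \<in> annihilator m"
proof -
  have "(r \<ominus> s) \<odot>\<^bsub>Q\<^esub> m = r \<odot>\<^bsub>Q\<^esub> m \<ominus>\<^bsub>Q\<^esub> s \<odot>\<^bsub>Q\<^esub> m"
    using assms by (simp add: minus_eq smult_l_distr smult_minus_left Q.minus_eq)
  then show ?thesis
    using assms unfolding annihilator_def 
    using Q.add.inv_solve_right[of "\<zero>\<^bsub>Q\<^esub>" "r \<odot>\<^bsub>Q\<^esub> m" "s \<odot>\<^bsub>Q\<^esub> m"]
    by (auto simp: Q.minus_eq)
qed

end

section \<open>Homomorphisms between cyclic modules R/Ra and R/Rb\<close>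

locale quot_pair = A: quot R a + B: quot R b for R (structure) and a b
begin

lemma lin_mapsI:
  assumes "\<And>m. m \<in> carrier A.Q \<Longrightarrow> h m \<in> carrier B.Q"
    and "\<And>m n. \<lbrakk>m \<in> carrier A.Q; n \<in> carrier A.Q\<rbrakk> \<Longrightarrow> h (m \<oplus>\<^bsub>A.Q\<^esub> n) = h m \<oplus>\<^bsub>B.Q\<^esub> h n"
    and "\<And>r m. \<lbrakk>r \<in> carrier R; m \<in> carrier A.Q\<rbrakk> \<Longrightarrow> h (r \<odot>\<^bsub>A.Q\<^esub> m) = r \<odot>\<^bsub>B.Q\<^esub> h m"
  shows "h \<in> lin_maps R A.Q B.Q"
  unfolding lin_maps_def hom_def using assms by auto

context
  fixes h assumes h: "h \<in> lin_maps R A.Q B.Q"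
begin

lemma lin_map_closed: "m \<in> carrier A.Q \<Longrightarrow> h m \<in> carrier B.Q"
  using h by (auto simp: lin_maps_def hom_def)

lemma lin_map_add: "\<lbrakk>m \<in> carrier A.Q; n \<in> carrier A.Q\<rbrakk> \<Longrightarrow> h (m \<oplus>\<^bsub>A.Q\<^esub> n) = h m \<oplus>\<^bsub>B.Q\<^esub> h n"
  using h by (auto simp: lin_maps_def hom_def)

lemma lin_map_smult: "\<lbrakk>r \<in> carrier R; m \<in> carrier A.Q\<rbrakk> \<Longrightarrow> h (r \<odot>\<^bsub>A.Q\<^esub> m) = r \<odot>\<^bsub>B.Q\<^esub> h m"
  using h by (auto simp: lin_maps_def)

lemma lin_map_zero: "h \<zero>\<^bsub>A.Q\<^esub> = \<zero>\<^bsub>B.Q\<^esub>"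
  using lin_map_add[of "\<zero>\<^bsub>A.Q\<^esub>" "\<zero>\<^bsub>A.Q\<^esub>"] lin_map_closed[of "\<zero>\<^bsub>A.Q\<^esub>"]
    B.Q.add.l_cancel_one'[of "h \<zero>\<^bsub>A.Q\<^esub>" "h \<zero>\<^bsub>A.Q\<^esub>"] by simp

end

text \<open>The map sends r m to r m'. Two coefficients of the same element differ by an element of
  \<open>A.annihilator m\<close>, hence of \<open>B.annihilator m'\<close>, so the coefficient
  picked by \<open>SOME\<close> does not affect the value. Extensionality makes the map an element
  of the endomorphism ring when both quotients coincide.\<close>

lemma lin_map_exists:
  assumes m: "m \<in> carrier A.Q" and gen: "\<And>y. y \<in> carrier A.Q \<Longrightarrow> \<exists>r\<in>carrier R. y = r \<odot>\<^bsub>A.Q\<^esub> m"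
    and m': "m' \<in> carrier B.Q" and ann: "A.annihilator m \<subseteq> B.annihilator m'"
  shows "\<exists>h\<in>lin_maps R A.Q B.Q \<inter> extensional (carrier A.Q). h m = m'"
proof -
  define h where "h = (\<lambda>y\<in>carrier A.Q. (SOME r. r \<in> carrier R \<and> y = r \<odot>\<^bsub>A.Q\<^esub> m) \<odot>\<^bsub>B.Q\<^esub> m')"
  have h: "h (r \<odot>\<^bsub>A.Q\<^esub> m) = r \<odot>\<^bsub>B.Q\<^esub> m'" if r: "r \<in> carrier R" for r
  proof -
    let ?s = "SOME s. s \<in> carrier R \<and> r \<odot>\<^bsub>A.Q\<^esub> m = s \<odot>\<^bsub>A.Q\<^esub> m"
    have "?s \<in> carrier R \<and> r \<odot>\<^bsub>A.Q\<^esub> m = ?s \<odot>\<^bsub>A.Q\<^esub> m" by (rule someI[of _ r]) (use r in auto)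
    then show ?thesis
      using r m m' ann A.smult_eq_iff[of r ?s m] B.smult_eq_iff[of r ?s m'] by (auto simp: h_def)
  qed
  have "h \<in> lin_maps R A.Q B.Q"
  proof (rule lin_mapsI)
    fix y assume "y \<in> carrier A.Q"
    then obtain r where "r \<in> carrier R" "y = r \<odot>\<^bsub>A.Q\<^esub> m" using gen by blast
    then show "h y \<in> carrier B.Q" using h m' by auto
  next
    fix y z assume "y \<in> carrier A.Q" "z \<in> carrier A.Q"
    then obtain r s where "r \<in> carrier R" "y = r \<odot>\<^bsub>A.Q\<^esub> m" "s \<in> carrier R" "z = s \<odot>\<^bsub>A.Q\<^esub> m"
      using gen by metis
    then show "h (y \<oplus>\<^bsub>A.Q\<^esub> z) = h y \<oplus>\<^bsub>B.Q\<^esub> h z"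
      using h m m' by (simp add: A.smult_l_distr[symmetric] B.smult_l_distr[symmetric])
  next
    fix r y assume r: "r \<in> carrier R" and "y \<in> carrier A.Q"
    then obtain s where "s \<in> carrier R" "y = s \<odot>\<^bsub>A.Q\<^esub> m" using gen by blast
    then show "h (r \<odot>\<^bsub>A.Q\<^esub> y) = r \<odot>\<^bsub>B.Q\<^esub> h y"
      using h r m m' by (simp add: A.smult_assoc[symmetric] B.smult_assoc[symmetric])
  qed
  moreover have "h m = m'" using h[of \<one>] m m' by simp
  moreover have "h \<in> extensional (carrier A.Q)" by (simp add: h_def)
  ultimately show ?thesis by blast
qed

end

text \<open>Both \<open>m\<close> and \<open>B.gen\<close> generate and have the same annihilator,
  so maps exist in both directions. They exchange the two generators and are therefore mutually
  inverse.\<close>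

lemma (in quot_pair) lin_iso_exists:
  assumes m: "m \<in> carrier A.Q" and gen: "\<And>y. y \<in> carrier A.Q \<Longrightarrow> \<exists>r\<in>carrier R. y = r \<odot>\<^bsub>A.Q\<^esub> m"
    and ann: "A.annihilator m = left_ideal_gen R b"
  shows "lin_isos R A.Q B.Q \<noteq> {}"
proof -
  interpret BA: quot_pair R b a by unfold_locales
  obtain h where h: "h \<in> lin_maps R A.Q B.Q" "h m = B.gen"
    using lin_map_exists[OF m gen, of B.gen] ann B.annihilator_gen by auto
  obtain k where k: "k \<in> lin_maps R B.Q A.Q" "k B.gen = m"
    using BA.lin_map_exists[OF _ B.gen_generates m] ann B.annihilator_gen by auto
  have "k (h y) = y" if "y \<in> carrier A.Q" for y
  proof -
    obtain r where "r \<in> carrier R" "y = r \<odot>\<^bsub>A.Q\<^esub> m" using gen \<open>y \<in> carrier A.Q\<close> by blast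
    then show ?thesis using h k m by (simp add: lin_map_smult[OF h(1)] BA.lin_map_smult[OF k(1)])
  qed
  moreover have "h (k y) = y" if y: "y \<in> carrier B.Q" for y
  proof -
    obtain r where "r \<in> carrier R" "y = r \<odot>\<^bsub>B.Q\<^esub> B.gen" using B.gen_generates y by blast
    then show ?thesis using h k m by (simp add: lin_map_smult[OF h(1)] BA.lin_map_smult[OF k(1)])
  qed
  ultimately have "bij_betw h (carrier A.Q) (carrier B.Q)"
    using lin_map_closed[OF h(1)] BA.lin_map_closed[OF k(1)]
    by (intro bij_betw_byWitness[where f' = k]) auto
  then show ?thesis using h(1) by (auto simp: lin_isos_def)
qed

lemma (in quot_pair) annihilator_iso:
  assumes h: "h \<in> lin_isos R A.Q B.Q" and m: "m \<in> carrier A.Q"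
  shows "B.annihilator (h m) = A.annihilator m"
proof -
  have hl: "h \<in> lin_maps R A.Q B.Q" and inj: "inj_on h (carrier A.Q)"
    using h by (auto simp: lin_isos_def bij_betw_def)
  have "r \<odot>\<^bsub>B.Q\<^esub> h m = \<zero>\<^bsub>B.Q\<^esub> \<longleftrightarrow> r \<odot>\<^bsub>A.Q\<^esub> m = \<zero>\<^bsub>A.Q\<^esub>" if r: "r \<in> carrier R" for r
    using inj_on_eq_iff[OF inj, of "r \<odot>\<^bsub>A.Q\<^esub> m" "\<zero>\<^bsub>A.Q\<^esub>"] r m
    by (simp add: lin_map_smult[OF hl] lin_map_zero[OF hl])
  then show ?thesis unfolding A.annihilator_def B.annihilator_def by blast
qed

section \<open>The endomorphism ring of R/Ra, acting on the right\<close>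

context quot
begin

abbreviation "C \<equiv> End_ring R Q"
abbreviation "V \<equiv> End_module Q"

sublocale self: quot_pair R a a by unfold_locales

lemma End_ring_simps:
  "carrier C = lin_maps R Q Q \<inter> extensional (carrier Q)"
  "c \<otimes>\<^bsub>C\<^esub> d = compose (carrier Q) d c"
  "\<one>\<^bsub>C\<^esub> = (\<lambda>x\<in>carrier Q. x)"
  "\<zero>\<^bsub>C\<^esub> = (\<lambda>x\<in>carrier Q. \<zero>\<^bsub>Q\<^esub>)"
  "c \<oplus>\<^bsub>C\<^esub> d = (\<lambda>x\<in>carrier Q. c x \<oplus>\<^bsub>Q\<^esub> d x)"
  by (simp_all add: End_ring_def)

lemma End_module_simps:
  "carrier V = carrier Q" "\<zero>\<^bsub>V\<^esub> = \<zero>\<^bsub>Q\<^esub>" "v \<oplus>\<^bsub>V\<^esub> w = v \<oplus>\<^bsub>Q\<^esub> w" "c \<odot>\<^bsub>V\<^esub> v = c v"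
  by (simp_all add: End_module_def)

lemma End_closed: "\<lbrakk>c \<in> carrier C; m \<in> carrier Q\<rbrakk> \<Longrightarrow> c m \<in> carrier Q"
  by (simp add: End_ring_simps self.lin_map_closed)

lemma End_add:
  "\<lbrakk>c \<in> carrier C; m \<in> carrier Q; n \<in> carrier Q\<rbrakk> \<Longrightarrow> c (m \<oplus>\<^bsub>Q\<^esub> n) = c m \<oplus>\<^bsub>Q\<^esub> c n"
  by (simp add: End_ring_simps self.lin_map_add)

lemma End_smult:
  "\<lbrakk>c \<in> carrier C; r \<in> carrier R; m \<in> carrier Q\<rbrakk> \<Longrightarrow> c (r \<odot>\<^bsub>Q\<^esub> m) = r \<odot>\<^bsub>Q\<^esub> c m"
  by (simp add: End_ring_simps self.lin_map_smult)

lemma End_eqI: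
  assumes "c \<in> carrier C" "d \<in> carrier C" "\<And>m. m \<in> carrier Q \<Longrightarrow> c m = d m"
  shows "c = d"
  using assms by (intro extensionalityI[of c "carrier Q"]) (auto simp: End_ring_simps)

lemma End_add_in:
  assumes "c \<in> carrier C" "d \<in> carrier C"
  shows "c \<oplus>\<^bsub>C\<^esub> d \<in> carrier C"
proof -
  have "(\<lambda>x\<in>carrier Q. c x \<oplus>\<^bsub>Q\<^esub> d x) \<in> lin_maps R Q Q"
    using assms
    by (intro self.lin_mapsI)
      (auto simp: End_closed End_add End_smult smult_r_distr Q.a_ac)
  then show ?thesis by (simp add: End_ring_simps)
qed

lemma End_mult_in:
  assumes "c \<in> carrier C" "d \<in> carrier C"
  shows "c \<otimes>\<^bsub>C\<^esub> d \<in> carrier C"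
proof -
  have "compose (carrier Q) d c \<in> lin_maps R Q Q"
    using assms
    by (intro self.lin_mapsI)
      (auto simp: compose_eq End_closed End_add End_smult)
  then show ?thesis by (simp add: End_ring_simps)
qed

lemma End_one_in: "\<one>\<^bsub>C\<^esub> \<in> carrier C"
proof -
  have "(\<lambda>x\<in>carrier Q. x) \<in> lin_maps R Q Q"
    by (intro self.lin_mapsI) auto
  then show ?thesis by (simp add: End_ring_simps)
qed

lemma End_zero_in: "\<zero>\<^bsub>C\<^esub> \<in> carrier C"
proof -
  have "(\<lambda>x\<in>carrier Q. \<zero>\<^bsub>Q\<^esub>) \<in> lin_maps R Q Q"
    by (intro self.lin_mapsI) auto
  then show ?thesis by (simp add: End_ring_simps)
qed

lemma End_minus_in:
  assumes "c \<in> carrier C"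
  shows "(\<lambda>x\<in>carrier Q. \<ominus>\<^bsub>Q\<^esub> c x) \<in> carrier C"
proof -
  have "(\<lambda>x\<in>carrier Q. \<ominus>\<^bsub>Q\<^esub> c x) \<in> lin_maps R Q Q"
    using assms
    by (intro self.lin_mapsI)
      (auto simp: End_closed End_add End_smult smult_minus_right Q.minus_add)
  then show ?thesis by (simp add: End_ring_simps)
qed

lemma End_apply:
  assumes "m \<in> carrier Q"
  shows "(c \<otimes>\<^bsub>C\<^esub> d) m = d (c m)" "\<one>\<^bsub>C\<^esub> m = m" "\<zero>\<^bsub>C\<^esub> m = \<zero>\<^bsub>Q\<^esub>" "(c \<oplus>\<^bsub>C\<^esub> d) m = c m \<oplus>\<^bsub>Q\<^esub> d m"
  using assms by (simp_all add: End_ring_simps compose_eq)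

lemmas End_in = End_add_in End_mult_in End_one_in End_zero_in

lemma End_ring: "ring C"
proof (rule ringI)
  show "abelian_group C"
  proof (rule abelian_groupI)
    fix c assume c: "c \<in> carrier C"
    let ?d = "\<lambda>x\<in>carrier Q. \<ominus>\<^bsub>Q\<^esub> c x"
    have "?d \<oplus>\<^bsub>C\<^esub> c = \<zero>\<^bsub>C\<^esub>"
      by (rule End_eqI) (auto simp: End_in End_minus_in c End_apply End_closed Q.l_neg)
    then show "\<exists>d\<in>carrier C. d \<oplus>\<^bsub>C\<^esub> c = \<zero>\<^bsub>C\<^esub>" using End_minus_in[OF c] by blast
  next
    fix c d e assume "c \<in> carrier C" "d \<in> carrier C" "e \<in> carrier C"
    then show "c \<oplus>\<^bsub>C\<^esub> d \<oplus>\<^bsub>C\<^esub> e = c \<oplus>\<^bsub>C\<^esub> (d \<oplus>\<^bsub>C\<^esub> e)"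
      by (intro End_eqI) (auto simp: End_in End_apply End_closed Q.a_assoc)
  next
    fix c d assume "c \<in> carrier C" "d \<in> carrier C"
    then show "c \<oplus>\<^bsub>C\<^esub> d = d \<oplus>\<^bsub>C\<^esub> c"
      by (intro End_eqI) (auto simp: End_in End_apply End_closed Q.a_comm)
  next
    fix c assume "c \<in> carrier C"
    then show "\<zero>\<^bsub>C\<^esub> \<oplus>\<^bsub>C\<^esub> c = c"
      by (intro End_eqI) (auto simp: End_in End_apply End_closed)
  qed (auto intro: End_in)
next
  show "monoid C"
  proof (rule monoidI)
    fix c d e assume "c \<in> carrier C" "d \<in> carrier C" "e \<in> carrier C"
    then show "c \<otimes>\<^bsub>C\<^esub> d \<otimes>\<^bsub>C\<^esub> e = c \<otimes>\<^bsub>C\<^esub> (d \<otimes>\<^bsub>C\<^esub> e)"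
      by (intro End_eqI) (auto simp: End_in End_apply End_closed)
  next
    fix c assume c: "c \<in> carrier C"
    then show "\<one>\<^bsub>C\<^esub> \<otimes>\<^bsub>C\<^esub> c = c"
      by (intro End_eqI) (auto simp: End_in End_apply End_closed)
    show "c \<otimes>\<^bsub>C\<^esub> \<one>\<^bsub>C\<^esub> = c"
      using c by (intro End_eqI) (auto simp: End_in End_apply End_closed)
  qed (auto intro: End_in)
next
  fix c d e assume cde: "c \<in> carrier C" "d \<in> carrier C" "e \<in> carrier C"
  then show "(c \<oplus>\<^bsub>C\<^esub> d) \<otimes>\<^bsub>C\<^esub> e = c \<otimes>\<^bsub>C\<^esub> e \<oplus>\<^bsub>C\<^esub> d \<otimes>\<^bsub>C\<^esub> e"
    by (intro End_eqI) (auto simp: End_in End_apply End_closed End_add)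
  show "e \<otimes>\<^bsub>C\<^esub> (c \<oplus>\<^bsub>C\<^esub> d) = e \<otimes>\<^bsub>C\<^esub> c \<oplus>\<^bsub>C\<^esub> e \<otimes>\<^bsub>C\<^esub> d"
    using cde by (intro End_eqI) (auto simp: End_in End_apply End_closed)
qed

lemma End_module_abelian_group: "abelian_group V"
  by (intro abelian_groupI) (auto simp: End_module_simps Q.a_ac intro: Q.l_neg)

text \<open>The two assumptions isolate what depends on the generator of the left ideal; the other
  axioms hold for every quotient. They are supplied below when the generator is an atom.\<close>

lemma End_module_right_vector_space:
  assumes "\<one>\<^bsub>C\<^esub> \<noteq> \<zero>\<^bsub>C\<^esub>"
    and "\<And>c. \<lbrakk>c \<in> carrier C; c \<noteq> \<zero>\<^bsub>C\<^esub>\<rbrakk> \<Longrightarrow> \<exists>d\<in>carrier C. c \<otimes>\<^bsub>C\<^esub> d = \<one>\<^bsub>C\<^esub>"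
  shows "right_vector_space C V"
proof -
  interpret C: ring C by (rule End_ring)
  interpret V: abelian_group V by (rule End_module_abelian_group)
  show ?thesis
    by unfold_locales
      (auto simp: End_module_simps End_closed End_add End_apply assms)
qed

end

section \<open>Torsion elements over a 2-fir\<close>

context two_fir
begin

section \<open>Cancellation, units and Bezout relations in a 2-fir\<close>

lemma mult_left_cancel:
  assumes "a \<in> carrier R" "x \<in> carrier R" "y \<in> carrier R" "a \<noteq> \<zero>" "a \<otimes> x = a \<otimes> y"
  shows "x = y"
proof -
  have "a \<otimes> (x \<ominus> y) = \<zero>" using assms by (simp add: minus_eq r_distr r_minus r_neg)
  then have "x \<ominus> y = \<zero>" using no_zero_divisors[of a "x \<ominus> y"] assms by auto
  moreover have "x = (x \<ominus> y) \<oplus> y" using assms(2,3) by (simp add: minus_eq a_assoc l_neg)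
  ultimately show ?thesis using assms(3) by simp
qed

lemma mult_right_cancel:
  assumes "a \<in> carrier R" "x \<in> carrier R" "y \<in> carrier R" "a \<noteq> \<zero>" "x \<otimes> a = y \<otimes> a"
  shows "x = y"
proof -
  have "(x \<ominus> y) \<otimes> a = \<zero>" using assms by (simp add: minus_eq l_distr l_minus r_neg)
  then have "x \<ominus> y = \<zero>" using no_zero_divisors[of "x \<ominus> y" a] assms by auto
  moreover have "x = (x \<ominus> y) \<oplus> y" using assms(2,3) by (simp add: minus_eq a_assoc l_neg)
  ultimately show ?thesis using assms(3) by simp
qed

text \<open>From b (a b) = (b a) b = b, cancelling b gives a b = 1: in a domain one-sided inverses
  are two-sided.\<close>

lemma unit_of_left_inverse:
  assumes "a \<in> carrier R" "b \<in> carrier R" "b \<otimes> a = \<one>"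
  shows "a \<in> Units R" "b \<in> Units R"
proof -
  have "a \<noteq> \<zero>" using assms one_not_zero by auto
  have b: "b \<noteq> \<zero>" using assms one_not_zero by auto
  have "b \<otimes> (a \<otimes> b) = b \<otimes> \<one>" using assms by (simp add: m_assoc[symmetric])
  then have "a \<otimes> b = \<one>" using mult_left_cancel[OF assms(2) _ _ b] assms by auto
  then show "a \<in> Units R" "b \<in> Units R" using assms by (auto simp: Units_def)
qed

lemma nonzero_mult: "\<lbrakk>a \<in> carrier R; b \<in> carrier R; a \<noteq> \<zero>; b \<noteq> \<zero>\<rbrakk> \<Longrightarrow> a \<otimes> b \<noteq> \<zero>"
  using no_zero_divisors by blast

lemma atom_closed: "q \<in> atoms R \<Longrightarrow> q \<in> carrier R"
  and atom_nonzero: "q \<in> atoms R \<Longrightarrow> q \<noteq> \<zero>"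
  and atom_nonunit: "q \<in> atoms R \<Longrightarrow> q \<notin> Units R"
  by (auto simp: atoms_def)

lemma atom_factor:
  "\<lbrakk>q \<in> atoms R; q = b \<otimes> c; b \<in> carrier R; c \<in> carrier R\<rbrakk> \<Longrightarrow> b \<in> Units R \<or> c \<in> Units R"
  by (auto simp: atoms_def)

text \<open>The defining condition of a 2-fir transferred to left ideals: \<open>R a + R b = R e\<close>, and
  \<open>R a1 \<inter> R b1\<close> is generated by \<open>u1 a1 = v1 b1\<close>. The proof splits the surjection
  \<open>(\<alpha>, \<beta>) \<mapsto> u1 \<alpha> + v1 \<beta>\<close>, whose kernel is free on \<open>(a1, -b1)\<close>; the splitting is
  \<open>(s, t)\<close>.\<close>

lemma left_bezout:
  assumes a: "a \<in> carrier R" and b: "b \<in> carrier R" and u: "u \<in> carrier R" and v: "v \<in> carrier R"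
    and eq: "u \<otimes> a = v \<otimes> b" and nz: "u \<otimes> a \<noteq> \<zero>"
  obtains a1 b1 e u1 v1 s t where
    "{a1, b1, e, u1, v1, s, t} \<subseteq> carrier R" "a = a1 \<otimes> e" "b = b1 \<otimes> e"
    "s \<otimes> a1 \<oplus> t \<otimes> b1 = \<one>" "u1 \<otimes> a1 = v1 \<otimes> b1"
    "\<And>g h. \<lbrakk>g \<in> carrier R; h \<in> carrier R; g \<otimes> a1 = h \<otimes> b1\<rbrakk> \<Longrightarrow> \<exists>k\<in>carrier R. g = k \<otimes> u1 \<and> h = k \<otimes> v1"
proof -
  have nz': "u \<noteq> \<zero>" "v \<noteq> \<zero>" "a \<noteq> \<zero>" "b \<noteq> \<zero>" using nz eq a b u v by auto
  have r_iff: "x \<in> right_ideal_gen R w \<longleftrightarrow> (\<exists>r\<in>carrier R. x = w \<otimes> r)" for x w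
    by (auto simp: right_ideal_gen_def)
  have sum_iff: "x \<in> right_ideal_gen R u <+>\<^bsub>R\<^esub> right_ideal_gen R v \<longleftrightarrow>
      (\<exists>r\<in>carrier R. \<exists>s\<in>carrier R. x = u \<otimes> r \<oplus> v \<otimes> s)" for x
    unfolding set_add_def' by (auto simp: right_ideal_gen_def)
  have "u \<otimes> a \<in> right_ideal_gen R u \<inter> right_ideal_gen R v" using a b eq r_iff by blast
  then obtain c d where c: "c \<in> carrier R" "right_ideal_gen R u \<inter> right_ideal_gen R v = right_ideal_gen R c"
    and d: "d \<in> carrier R" "right_ideal_gen R u <+>\<^bsub>R\<^esub> right_ideal_gen R v = right_ideal_gen R d"
    using right_ideals_principal[OF u v] nz by blast
  have "u = u \<otimes> \<one> \<oplus> v \<otimes> \<zero>" "v = u \<otimes> \<zero> \<oplus> v \<otimes> \<one>" using u v by simp_all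
  then have "u \<in> right_ideal_gen R d" "v \<in> right_ideal_gen R d"
    unfolding d(2)[symmetric] sum_iff by (metis one_closed zero_closed)+
  then obtain u1 v1 where u1: "u1 \<in> carrier R" "u = d \<otimes> u1" and v1: "v1 \<in> carrier R" "v = d \<otimes> v1"
    unfolding r_iff by blast
  have dnz: "d \<noteq> \<zero>" using nz' u1 by auto
  have "d \<in> right_ideal_gen R d" unfolding r_iff using d(1) by (metis one_closed r_one)
  then obtain x y where xy: "x \<in> carrier R" "y \<in> carrier R" "d = u \<otimes> x \<oplus> v \<otimes> y"
    unfolding d(2)[symmetric] sum_iff by blast
  have "d \<otimes> (u1 \<otimes> x \<oplus> v1 \<otimes> y) = u \<otimes> x \<oplus> v \<otimes> y"
    unfolding u1(2) v1(2) using xy(1,2) u1(1) v1(1) d(1) by (simp add: r_distr m_assoc)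
  then have "d \<otimes> (u1 \<otimes> x \<oplus> v1 \<otimes> y) = d \<otimes> \<one>" using xy(3) d(1) by simp
  then have one: "u1 \<otimes> x \<oplus> v1 \<otimes> y = \<one>"
    using mult_left_cancel[OF d(1) _ _ dnz] xy(1,2) u1(1) v1(1) by auto
  have "c \<in> right_ideal_gen R c" unfolding r_iff using c(1) by (metis one_closed r_one)
  then obtain a1 b1 where a1: "a1 \<in> carrier R" "c = u \<otimes> a1" and b1: "b1 \<in> carrier R" "c = v \<otimes> b1"
    unfolding c(2)[symmetric] r_iff Int_iff by blast
  have "d \<otimes> (u1 \<otimes> a1) = d \<otimes> (v1 \<otimes> b1)"
    using a1 b1 u1 v1 d(1) by (metis m_assoc)
  then have comm: "u1 \<otimes> a1 = v1 \<otimes> b1"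
    using mult_left_cancel[OF d(1) _ _ dnz] a1(1) b1(1) u1(1) v1(1) by auto
  \<comment> \<open>Multiplying by \<open>d\<close> turns the equation into
    \<open>u \<otimes> \<alpha> = v \<otimes> \<beta>\<close>, an element of the intersection
    generated by \<open>c = u \<otimes> a1 = v \<otimes> b1\<close>; cancelling \<open>u\<close> and
    \<open>v\<close> gives the same factor \<open>s\<close> for both.\<close>
  have kernel: "\<exists>s\<in>carrier R. \<alpha> = a1 \<otimes> s \<and> \<beta> = b1 \<otimes> s"
    if \<alpha>: "\<alpha> \<in> carrier R" and \<beta>: "\<beta> \<in> carrier R" and eq: "u1 \<otimes> \<alpha> = v1 \<otimes> \<beta>" for \<alpha> \<beta>
  proof -
    have eq': "u \<otimes> \<alpha> = v \<otimes> \<beta>" using u1 v1 d(1) \<alpha> \<beta> eq by (simp add: m_assoc)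
    then have "u \<otimes> \<alpha> \<in> right_ideal_gen R c"
      unfolding c(2)[symmetric] r_iff Int_iff using \<alpha> \<beta> by blast
    then obtain s where s: "s \<in> carrier R" "u \<otimes> \<alpha> = c \<otimes> s" unfolding r_iff by blast
    have "u \<otimes> \<alpha> = u \<otimes> (a1 \<otimes> s)" using s a1(1) u by (simp add: a1(2) m_assoc)
    moreover have "v \<otimes> \<beta> = v \<otimes> (b1 \<otimes> s)" using s(1) b1(1) v by (simp add: eq'[symmetric] s(2) b1(2) m_assoc)
    ultimately show ?thesis
      using mult_left_cancel[OF u \<alpha> _ nz'(1)] mult_left_cancel[OF v \<beta> _ nz'(2)] a1 b1 s by blast
  qed
  have "d \<otimes> (u1 \<otimes> a) = d \<otimes> (v1 \<otimes> b)"
    using a b u1 v1 d(1) eq by (metis m_assoc)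
  then have "u1 \<otimes> a = v1 \<otimes> b"
    using mult_left_cancel[OF d(1) _ _ dnz] a b u1(1) v1(1) by auto
  then obtain e where e: "e \<in> carrier R" "a = a1 \<otimes> e" "b = b1 \<otimes> e" using kernel[OF a b] by blast
  have a1nz: "a1 \<noteq> \<zero>" using e(1,2) nz'(3) by auto
  \<comment> \<open>Since \<open>x\<close> and \<open>y\<close> split the map onto R, the defect of
    the splitting at the first basis vector lies in the kernel, which produces \<open>s\<close>. The
    second basis vector produces \<open>t\<close> in the same way.\<close>
  have "u1 \<otimes> (\<one> \<ominus> x \<otimes> u1) = (\<one> \<ominus> u1 \<otimes> x) \<otimes> u1"
    using xy(1,2) u1(1) by (simp add: minus_eq l_distr r_distr l_minus r_minus m_assoc)
  also have "\<one> \<ominus> u1 \<otimes> x = v1 \<otimes> y"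
    unfolding one[symmetric] using xy(1,2) u1(1) v1(1)
    by (simp add: minus_eq a_comm[of "u1 \<otimes> x" "v1 \<otimes> y"] a_assoc r_neg)
  finally have "u1 \<otimes> (\<one> \<ominus> x \<otimes> u1) = v1 \<otimes> (y \<otimes> u1)" using xy(1,2) u1(1) v1(1) by (simp add: m_assoc)
  then obtain s where s: "s \<in> carrier R" "\<one> \<ominus> x \<otimes> u1 = a1 \<otimes> s" "y \<otimes> u1 = b1 \<otimes> s"
    using kernel[of "\<one> \<ominus> x \<otimes> u1" "y \<otimes> u1"] xy(1,2) u1(1) by auto
  have "v1 \<otimes> (\<one> \<ominus> y \<otimes> v1) = (\<one> \<ominus> v1 \<otimes> y) \<otimes> v1"
    using xy(1,2) v1(1) by (simp add: minus_eq l_distr r_distr l_minus r_minus m_assoc)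
  also have "\<one> \<ominus> v1 \<otimes> y = u1 \<otimes> x"
    unfolding one[symmetric] using xy(1,2) u1(1) v1(1) by (simp add: minus_eq a_assoc r_neg)
  finally have "u1 \<otimes> (x \<otimes> v1) = v1 \<otimes> (\<one> \<ominus> y \<otimes> v1)" using xy(1,2) u1(1) v1(1) by (simp add: m_assoc)
  then obtain t where t: "t \<in> carrier R" "x \<otimes> v1 = a1 \<otimes> t" "\<one> \<ominus> y \<otimes> v1 = b1 \<otimes> t"
    using kernel[of "x \<otimes> v1" "\<one> \<ominus> y \<otimes> v1"] xy(1,2) v1(1) by auto
  have split_u: "x \<otimes> u1 \<oplus> a1 \<otimes> s = \<one>"
    unfolding s(2)[symmetric] using xy(1,2) u1(1)
    by (simp add: minus_eq a_lcomm[of "x \<otimes> u1" \<one>] r_neg)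
  have split_v: "y \<otimes> v1 \<oplus> b1 \<otimes> t = \<one>"
    unfolding t(3)[symmetric] using xy(1,2) v1(1)
    by (simp add: minus_eq a_lcomm[of "y \<otimes> v1" \<one>] r_neg)
  \<comment> \<open>After multiplication by \<open>a1\<close>, the sum becomes (1 - x u1) a1 + x v1
    b1, which is \<open>a1\<close> because \<open>u1 \<otimes> a1 = v1 \<otimes> b1\<close>; then
    \<open>a1\<close> is cancelled.\<close>
  have "a1 \<otimes> (s \<otimes> a1 \<oplus> t \<otimes> b1) = (a1 \<otimes> s) \<otimes> a1 \<oplus> (a1 \<otimes> t) \<otimes> b1"
    using s(1) t(1) a1(1) b1(1) by (simp add: r_distr m_assoc)
  also have "\<dots> = (a1 \<otimes> s) \<otimes> a1 \<oplus> x \<otimes> (u1 \<otimes> a1)"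
    unfolding t(2)[symmetric] comm using xy(1,2) v1(1) b1(1) by (simp add: m_assoc)
  also have "\<dots> = (x \<otimes> u1 \<oplus> a1 \<otimes> s) \<otimes> a1"
    using xy(1,2) u1(1) a1(1) s(1) by (simp add: l_distr m_assoc a_comm)
  finally have "a1 \<otimes> (s \<otimes> a1 \<oplus> t \<otimes> b1) = a1 \<otimes> \<one>" using split_u a1(1) by simp
  then have bez: "s \<otimes> a1 \<oplus> t \<otimes> b1 = \<one>"
    using mult_left_cancel[OF a1(1) _ _ a1nz] a1(1) b1(1) s(1) t(1) by auto
  \<comment> \<open>The factor is k = g x + h y: expand g = g (x u1 + a1 s), and replace g a1 s by h
    b1 s = h y u1. The expansion of h yields the same k.\<close>
  have "\<exists>k\<in>carrier R. g = k \<otimes> u1 \<and> h = k \<otimes> v1"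
    if g: "g \<in> carrier R" and h: "h \<in> carrier R" and gh: "g \<otimes> a1 = h \<otimes> b1" for g h
  proof -
    have "g = g \<otimes> (x \<otimes> u1 \<oplus> a1 \<otimes> s)" using split_u g by simp
    also have "\<dots> = g \<otimes> x \<otimes> u1 \<oplus> (g \<otimes> a1) \<otimes> s"
      using g xy(1,2) u1(1) a1(1) s(1) by (simp add: r_distr m_assoc)
    also have "\<dots> = g \<otimes> x \<otimes> u1 \<oplus> h \<otimes> (y \<otimes> u1)"
      unfolding gh s(3) using h b1(1) s(1) by (simp add: m_assoc)
    also have "\<dots> = (g \<otimes> x \<oplus> h \<otimes> y) \<otimes> u1" using g h xy(1,2) u1(1) by (simp add: l_distr m_assoc)
    finally have gk: "g = (g \<otimes> x \<oplus> h \<otimes> y) \<otimes> u1" .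
    have "h = h \<otimes> (y \<otimes> v1 \<oplus> b1 \<otimes> t)" using split_v h by simp
    also have "\<dots> = h \<otimes> y \<otimes> v1 \<oplus> (h \<otimes> b1) \<otimes> t"
      using h xy(1,2) v1(1) b1(1) t(1) by (simp add: r_distr m_assoc)
    also have "\<dots> = h \<otimes> y \<otimes> v1 \<oplus> g \<otimes> (x \<otimes> v1)"
      unfolding gh[symmetric] t(2) using g a1(1) t(1) by (simp add: m_assoc)
    also have "\<dots> = (g \<otimes> x \<oplus> h \<otimes> y) \<otimes> v1" using g h xy(1,2) v1(1) by (simp add: l_distr m_assoc a_comm)
    finally have "h = (g \<otimes> x \<oplus> h \<otimes> y) \<otimes> v1" .
    then show ?thesis using gk g h xy(1,2) by blast
  qed
  then show ?thesis using that[of a1 b1 e u1 v1 s t] a1(1) b1(1) e u1(1) v1(1) s(1) t(1) bez comm by blast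
qed

text \<open>The nonzero common left multiple \<open>f\<close> makes the Bezout relation available:
  Rq + Rg = Re with q = a1 e and g = b1 e. As q is an atom, either e is a unit and the sum is R, or
  a1 is a unit and g is a left multiple of q. This turns the comaximality test in
  \<open>F_dependent_on\<close> into divisibility.\<close>

lemma atom_comaximal_iff:
  assumes q: "q \<in> atoms R" and g: "g \<in> carrier R"
    and f: "f \<in> left_ideal_gen R q" "f \<in> left_ideal_gen R g" "f \<noteq> \<zero>"
  shows "left_ideal_gen R q <+>\<^bsub>R\<^esub> left_ideal_gen R g \<noteq> carrier R \<longleftrightarrow> g \<in> left_ideal_gen R q"
proof -
  note qc = atom_closed[OF q]
  have sum_iff: "x \<in> left_ideal_gen R q <+>\<^bsub>R\<^esub> left_ideal_gen R g \<longleftrightarrow>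
      (\<exists>r\<in>carrier R. \<exists>s\<in>carrier R. x = r \<otimes> q \<oplus> s \<otimes> g)" for x
    unfolding set_add_def' by (auto simp: left_ideal_gen_def)
  obtain u v where uv: "u \<in> carrier R" "v \<in> carrier R" "f = u \<otimes> q" "f = v \<otimes> g"
    using f unfolding left_ideal_gen_iff by blast
  show ?thesis
  proof
    assume ne: "left_ideal_gen R q <+>\<^bsub>R\<^esub> left_ideal_gen R g \<noteq> carrier R"
    obtain a1 b1 e u1 v1 s t where *: "{a1, b1, e, u1, v1, s, t} \<subseteq> carrier R" "q = a1 \<otimes> e" "g = b1 \<otimes> e"
      "s \<otimes> a1 \<oplus> t \<otimes> b1 = \<one>"
      using left_bezout[OF qc g uv(1,2)] uv(3,4) f(3) by metis
    then have cl: "a1 \<in> carrier R" "b1 \<in> carrier R" "e \<in> carrier R" "s \<in> carrier R" "t \<in> carrier R"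
      by auto
    have "e \<notin> Units R"
    proof
      assume e: "e \<in> Units R"
      have "x \<in> left_ideal_gen R q <+>\<^bsub>R\<^esub> left_ideal_gen R g" if x: "x \<in> carrier R" for x
      proof -
        let ?y = "x \<otimes> inv e"
        have y: "?y \<in> carrier R" using x e by simp
        have "(?y \<otimes> s) \<otimes> q \<oplus> (?y \<otimes> t) \<otimes> g = ?y \<otimes> (s \<otimes> a1 \<oplus> t \<otimes> b1) \<otimes> e"
          unfolding *(2,3) using cl y by (simp add: r_distr l_distr m_assoc)
        also have "\<dots> = x" using *(4) x e cl by (simp add: m_assoc)
        finally show ?thesis unfolding sum_iff using y cl by (metis m_closed)
      qed
      moreover have "left_ideal_gen R q <+>\<^bsub>R\<^esub> left_ideal_gen R g \<subseteq> carrier R"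
        unfolding subset_iff sum_iff using qc g by auto
      ultimately show False using ne by blast
    qed
    then have a1: "a1 \<in> Units R" using atom_factor[OF q *(2)] cl by blast
    then have "g = (b1 \<otimes> inv a1) \<otimes> q" unfolding *(2,3) using cl
      by (simp add: m_assoc) (simp add: m_assoc[symmetric])
    then show "g \<in> left_ideal_gen R q"
      unfolding left_ideal_gen_iff using a1 cl by blast
  next
    assume "g \<in> left_ideal_gen R q"
    then obtain w where w: "w \<in> carrier R" "g = w \<otimes> q" unfolding left_ideal_gen_iff by blast
    show "left_ideal_gen R q <+>\<^bsub>R\<^esub> left_ideal_gen R g \<noteq> carrier R"
    proof
      assume "left_ideal_gen R q <+>\<^bsub>R\<^esub> left_ideal_gen R g = carrier R"
      then obtain r s where "r \<in> carrier R" "s \<in> carrier R" "\<one> = r \<otimes> q \<oplus> s \<otimes> g"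
        using sum_iff one_closed by metis
      \<comment> \<open>If g = w q, a Bezout relation for 1 would give q a left inverse, making it a
        unit.\<close>
      then have "(r \<oplus> s \<otimes> w) \<otimes> q = \<one>" "r \<oplus> s \<otimes> w \<in> carrier R"
        using w qc by (simp_all add: l_distr m_assoc)
      then show False using unit_of_left_inverse[OF qc] atom_nonunit[OF q] by blast
    qed
  qed
qed

end

section \<open>Torsion elements of R/Rp and Schur's lemma for them\<close>

locale fir_atom = two_fir R for R (structure) and p +
  assumes p_atom: "p \<in> atoms R"

sublocale fir_atom \<subseteq> quot R p
  by unfold_locales (rule atom_closed[OF p_atom])

context fir_atom
begin

text \<open>The torsion hypothesis is essential, as \<open>R / R p\<close> need not be a simple module.\<close>

lemma torsion_generates:
  assumes m: "m \<in> carrier Q" "m \<noteq> \<zero>\<^bsub>Q\<^esub>" and r: "r \<in> annihilator m" "r \<noteq> \<zero>"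
  shows "y \<in> carrier Q \<Longrightarrow> \<exists>s\<in>carrier R. y = s \<odot>\<^bsub>Q\<^esub> m"
    and "\<exists>q\<in>carrier R. annihilator m = left_ideal_gen R q"
proof -
  note pc = gen_closed
  obtain x where x: "x \<in> carrier R" "m = x \<odot>\<^bsub>Q\<^esub> gen" using gen_generates[OF m(1)] by blast
  have ann: "s \<in> annihilator m \<longleftrightarrow> s \<in> carrier R \<and> s \<otimes> x \<in> left_ideal_gen R p" for s
    unfolding annihilator_def x(2) using x(1) smult_gen_zero_iff[of "s \<otimes> x"] smult_assoc[of s x gen] by auto
  have xp: "x \<notin> left_ideal_gen R p" using m(2) x smult_gen_zero_iff by blast
  then have "x \<noteq> \<zero>" using left_ideal_gen_iff[of x p] pc by (metis l_null zero_closed)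
  \<comment> \<open>That \<open>r\<close> kills \<open>m\<close> means r x = w p, and this common
    left multiple is nonzero; so Bezout applies to \<open>x\<close> and \<open>p\<close>.\<close>
  moreover obtain w where w: "w \<in> carrier R" "r \<otimes> x = w \<otimes> p" and rc: "r \<in> carrier R"
    using r(1) ann left_ideal_gen_iff by blast
  ultimately obtain a1 b1 e u1 v1 s t where *: "{a1, b1, e, u1, v1, s, t} \<subseteq> carrier R"
      "x = a1 \<otimes> e" "p = b1 \<otimes> e" "s \<otimes> a1 \<oplus> t \<otimes> b1 = \<one>" "u1 \<otimes> a1 = v1 \<otimes> b1"
      "\<And>g h. \<lbrakk>g \<in> carrier R; h \<in> carrier R; g \<otimes> a1 = h \<otimes> b1\<rbrakk> \<Longrightarrow>
        \<exists>k\<in>carrier R. g = k \<otimes> u1 \<and> h = k \<otimes> v1"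
    using left_bezout[OF x(1) pc rc w(1,2)] nonzero_mult[OF rc x(1) r(2)] by metis
  then have cl: "a1 \<in> carrier R" "b1 \<in> carrier R" "e \<in> carrier R" "s \<in> carrier R" "t \<in> carrier R"
      "u1 \<in> carrier R" "v1 \<in> carrier R"
    by auto
  \<comment> \<open>If \<open>b1\<close> were a unit, \<open>e\<close> and hence \<open>x\<close>
    would lie in Rp and \<open>m\<close> would be zero. Since p = b1 e is an atom, \<open>e\<close>
    must be a unit.\<close>
  have "b1 \<notin> Units R"
  proof
    assume b1: "b1 \<in> Units R"
    then have "x = (a1 \<otimes> inv b1) \<otimes> p" unfolding *(2,3) using cl
      by (simp add: m_assoc) (simp add: m_assoc[symmetric])
    then show False using xp b1 cl left_ideal_gen_iff[of x p] by blast
  qed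
  then have e: "e \<in> Units R" using atom_factor[OF p_atom *(3)] cl by blast
  then have enz: "e \<noteq> \<zero>" using one_not_zero Units_l_inv[OF e] Units_inv_closed[OF e] r_null by metis
  show "\<exists>s\<in>carrier R. y = s \<odot>\<^bsub>Q\<^esub> m" if "y \<in> carrier Q"
  proof -
    obtain z where z: "z \<in> carrier R" "y = z \<odot>\<^bsub>Q\<^esub> gen" using gen_generates[OF \<open>y \<in> carrier Q\<close>] by blast
    let ?y = "z \<otimes> inv e"
    have y: "?y \<in> carrier R" using z e by simp
    \<comment> \<open>Because \<open>e\<close> is a unit, Rx + Rp = R; modulo Rp this expresses any
      coset as a multiple of \<open>m\<close>.\<close>
    have "z = ?y \<otimes> (s \<otimes> a1 \<oplus> t \<otimes> b1) \<otimes> e" using *(4) z e cl by (simp add: m_assoc)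
    also have "\<dots> = (?y \<otimes> s) \<otimes> x \<oplus> (?y \<otimes> t) \<otimes> p"
      unfolding *(2,3) using cl y by (simp add: r_distr l_distr m_assoc)
    finally have "y = ((?y \<otimes> s) \<otimes> x \<oplus> (?y \<otimes> t) \<otimes> p) \<odot>\<^bsub>Q\<^esub> gen" using z(2) by simp
    also have "\<dots> = ((?y \<otimes> s) \<otimes> x) \<odot>\<^bsub>Q\<^esub> gen \<oplus>\<^bsub>Q\<^esub> ((?y \<otimes> t) \<otimes> p) \<odot>\<^bsub>Q\<^esub> gen"
      using y cl x pc by (intro smult_l_distr) auto
    also have "((?y \<otimes> t) \<otimes> p) \<odot>\<^bsub>Q\<^esub> gen = \<zero>\<^bsub>Q\<^esub>"
      using y cl pc smult_gen_zero_iff[of "(?y \<otimes> t) \<otimes> p"] left_ideal_gen_iff by (metis m_closed)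
    finally have "y = (?y \<otimes> s) \<odot>\<^bsub>Q\<^esub> m" using y cl x by (simp add: smult_assoc)
    then show ?thesis using y cl by (metis m_closed)
  qed
  \<comment> \<open>After cancelling \<open>e\<close>, g x = h p becomes g a1 = h b1, and all such g
    are left multiples of \<open>u1\<close>.\<close>
  have "annihilator m = left_ideal_gen R u1"
  proof (intro equalityI subsetI)
    fix g assume "g \<in> annihilator m"
    then obtain h where h: "g \<in> carrier R" "h \<in> carrier R" "g \<otimes> x = h \<otimes> p"
      using ann left_ideal_gen_iff by blast
    then have "(g \<otimes> a1) \<otimes> e = (h \<otimes> b1) \<otimes> e" unfolding *(2,3) using cl by (simp add: m_assoc)
    then have "g \<otimes> a1 = h \<otimes> b1" using mult_right_cancel[OF cl(3) _ _ enz] h cl by auto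
    then show "g \<in> left_ideal_gen R u1" using *(6)[OF h(1,2)] left_ideal_gen_iff by blast
  next
    fix g assume "g \<in> left_ideal_gen R u1"
    then obtain k where k: "k \<in> carrier R" "g = k \<otimes> u1" unfolding left_ideal_gen_iff by blast
    have "u1 \<otimes> x = (u1 \<otimes> a1) \<otimes> e" unfolding *(2) using cl by (simp add: m_assoc)
    also have "\<dots> = v1 \<otimes> p" unfolding *(3,5) using cl by (simp add: m_assoc)
    finally have "g \<otimes> x = (k \<otimes> v1) \<otimes> p" using k cl x pc by (simp add: m_assoc)
    then show "g \<in> annihilator m" unfolding ann left_ideal_gen_iff using k cl by blast
  qed
  then show "\<exists>q\<in>carrier R. annihilator m = left_ideal_gen R q" using cl by blast
qed

lemma annihilator_left_ideal:
  "\<lbrakk>m \<in> carrier Q; x \<in> annihilator m; r \<in> carrier R\<rbrakk> \<Longrightarrow> r \<otimes> x \<in> annihilator m"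
  by (simp add: annihilator_def smult_assoc)

lemma one_in_annihilator: "m \<in> carrier Q \<Longrightarrow> \<one> \<in> annihilator m \<longleftrightarrow> m = \<zero>\<^bsub>Q\<^esub>"
  by (simp add: annihilator_def)

lemma annihilator_generator_nonunit:
  assumes "m \<in> carrier Q" "m \<noteq> \<zero>\<^bsub>Q\<^esub>" "q \<in> carrier R" "annihilator m = left_ideal_gen R q"
  shows "q \<notin> Units R"
  using assms one_in_annihilator[of m] left_ideal_gen_iff[of \<one> q] Units_l_inv_ex[of q] by metis

text \<open>Let q = b c with b and c non-units. Then c m is nonzero, since c in Rq would make b a
  unit. But b kills c m, so c m is torsion and generates: m = s c m. Hence 1 - s c lies in Rq, thus
  in Rc, and c is a unit.\<close>

lemma annihilator_generator_atom:
  assumes m: "m \<in> carrier Q" "m \<noteq> \<zero>\<^bsub>Q\<^esub>" and q: "q \<in> carrier R" "q \<noteq> \<zero>" "annihilator m = left_ideal_gen R q"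
  shows "q \<in> atoms R"
proof -
  have "b \<in> Units R \<or> c \<in> Units R" if bc: "b \<in> carrier R" "c \<in> carrier R" "q = b \<otimes> c" for b c
  proof (rule ccontr)
    assume nu: "\<not> ?thesis"
    have nz: "b \<noteq> \<zero>" "c \<noteq> \<zero>" using bc q by auto
    have "c \<notin> annihilator m"
    proof
      assume "c \<in> annihilator m"
      then obtain d where d: "d \<in> carrier R" "c = d \<otimes> q" using q left_ideal_gen_iff by blast
      then have "(d \<otimes> b) \<otimes> c = \<one> \<otimes> c" using bc by (simp add: m_assoc)
      then have "d \<otimes> b = \<one>" using mult_right_cancel[OF bc(2) _ _ nz(2)] d(1) bc(1) by auto
      then show False using unit_of_left_inverse[of b d] d(1) bc(1) nu by blast
    qed
    then have cm: "c \<odot>\<^bsub>Q\<^esub> m \<noteq> \<zero>\<^bsub>Q\<^esub>" using bc by (simp add: annihilator_def)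
    have "q \<in> annihilator m" using q left_ideal_gen_self by blast
    then have "b \<in> annihilator (c \<odot>\<^bsub>Q\<^esub> m)" using bc m by (simp add: annihilator_def smult_assoc)
    then obtain s where s: "s \<in> carrier R" "m = s \<odot>\<^bsub>Q\<^esub> (c \<odot>\<^bsub>Q\<^esub> m)"
      using torsion_generates(1)[of "c \<odot>\<^bsub>Q\<^esub> m" b m] bc m cm nz by blast
    then have "\<one> \<odot>\<^bsub>Q\<^esub> m = (s \<otimes> c) \<odot>\<^bsub>Q\<^esub> m" using m bc by (simp add: smult_assoc)
    then have "\<one> \<ominus> s \<otimes> c \<in> left_ideal_gen R q"
      using smult_eq_iff[of \<one> "s \<otimes> c" m] s bc m q by simp
    then obtain t where t: "t \<in> carrier R" "\<one> \<ominus> s \<otimes> c = t \<otimes> q" unfolding left_ideal_gen_iff by blast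
    have "(t \<otimes> b \<oplus> s) \<otimes> c = (\<one> \<ominus> s \<otimes> c) \<oplus> s \<otimes> c"
      unfolding t(2) bc(3) using t(1) s bc by (simp add: l_distr m_assoc)
    also have "\<dots> = \<one>" using s bc by (simp add: minus_eq a_assoc l_neg)
    finally show False using unit_of_left_inverse[of c "t \<otimes> b \<oplus> s"] t s bc nu by auto
  qed
  then show ?thesis
    using annihilator_generator_nonunit[OF m q(1,3)] q unfolding atoms_def by auto
qed

text \<open>Since m generates, R/Rp is isomorphic to R modulo the annihilator of m.\<close>

lemma annihilator_generator_similar:
  assumes m: "m \<in> carrier Q" "m \<noteq> \<zero>\<^bsub>Q\<^esub>" and q: "q \<in> carrier R" "q \<noteq> \<zero>" "annihilator m = left_ideal_gen R q"
  shows "q \<in> similarity_class R p"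
proof -
  interpret P: quot_pair R p q by unfold_locales (rule q(1))
  have "q \<in> annihilator m" using q left_ideal_gen_self by blast
  then have "lin_isos R Q (quot_module R q) \<noteq> {}"
    using P.lin_iso_exists[OF m(1) torsion_generates(1)[OF m _ q(2)] q(3)] by blast
  then show ?thesis
    using q atom_nonzero[OF p_atom] by (simp add: similarity_class_def)
qed

text \<open>As m generates, r m \<mapsto> r n defines an endomorphism. This is the source of all
  scalars used below: elements of equal annihilator are multiples of each other.\<close>

lemma End_transitive:
  assumes m: "m \<in> carrier Q" "m \<noteq> \<zero>\<^bsub>Q\<^esub>" and r: "r \<in> annihilator m" "r \<noteq> \<zero>"
    and n: "n \<in> carrier Q" "annihilator m \<subseteq> annihilator n"
  shows "\<exists>c\<in>carrier C. c m = n"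
  using self.lin_map_exists[OF m(1) torsion_generates(1)[OF m r] n] by (simp add: End_ring_simps)

lemma gen_nonzero: "gen \<noteq> \<zero>\<^bsub>Q\<^esub>"
  using annihilator_gen one_in_annihilator[OF gen_in] atom_nonunit[OF p_atom]
    left_ideal_gen_iff[of \<one> p] unit_of_left_inverse(1)[OF gen_closed] by metis

text \<open>If the annihilator is Rq', then q = u q'. Here q' is a non-unit because m is nonzero, so
  u is a unit and Rq = Rq'. Thus a single atom that kills m determines the whole
  annihilator.\<close>

lemma annihilator_generator_unique:
  assumes m: "m \<in> carrier Q" "m \<noteq> \<zero>\<^bsub>Q\<^esub>" and q: "q \<in> atoms R" "q \<in> annihilator m"
  shows "annihilator m = left_ideal_gen R q"
proof -
  note qc = atom_closed[OF q(1)]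
  obtain q' where q': "q' \<in> carrier R" "annihilator m = left_ideal_gen R q'"
    using torsion_generates(2)[OF m q(2) atom_nonzero[OF q(1)]] by blast
  then obtain u where u: "u \<in> carrier R" "q = u \<otimes> q'" using q(2) left_ideal_gen_iff by blast
  have "u \<in> Units R"
    using atom_factor[OF q(1) u(2) u(1) q'(1)] annihilator_generator_nonunit[OF m q'] by blast
  then have "inv u \<in> carrier R" "q' = inv u \<otimes> q"
    using u q' by (simp_all add: m_assoc[symmetric])
  then have "q' \<in> left_ideal_gen R q" unfolding left_ideal_gen_iff by blast
  then have "left_ideal_gen R q' \<subseteq> left_ideal_gen R q"
    by (auto simp: left_ideal_gen_iff[of _ q'] intro: left_ideal_gen_mult[OF qc])
  moreover have "left_ideal_gen R q \<subseteq> annihilator m"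
    by (auto simp: left_ideal_gen_iff[of _ q] intro: annihilator_left_ideal[OF m(1) q(2)])
  ultimately show ?thesis using q'(2) by blast
qed

text \<open>Schur's lemma without simplicity. An endomorphism is determined by its value at
  \<open>gen\<close>; for nonzero c, the element \<open>c gen\<close> is nonzero and killed by the
  atom p, so its annihilator is Rp, that of \<open>gen\<close>, and some scalar carries it back to
  \<open>gen\<close>.\<close>

lemma right_vector_space: "right_vector_space C V"
proof (rule End_module_right_vector_space)
  show "\<one>\<^bsub>C\<^esub> \<noteq> \<zero>\<^bsub>C\<^esub>" using End_apply(2,3)[OF gen_in] gen_nonzero by metis
next
  fix c assume c: "c \<in> carrier C" "c \<noteq> \<zero>\<^bsub>C\<^esub>"
  have eq: "d = e" if "d \<in> carrier C" "e \<in> carrier C" "d gen = e gen" for d e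
  proof (rule End_eqI[OF that(1,2)])
    fix m assume "m \<in> carrier Q"
    then obtain x where "x \<in> carrier R" "m = x \<odot>\<^bsub>Q\<^esub> gen" using gen_generates by blast
    then show "d m = e m" using that by (simp add: End_smult)
  qed
  have cg: "c gen \<in> carrier Q" "c gen \<noteq> \<zero>\<^bsub>Q\<^esub>"
    using c eq[OF c(1) End_zero_in] End_apply(3)[OF gen_in] End_closed by auto
  have "p \<odot>\<^bsub>Q\<^esub> c gen = c (p \<odot>\<^bsub>Q\<^esub> gen)" using c gen_closed by (simp add: End_smult)
  also have "\<dots> = \<zero>\<^bsub>Q\<^esub>"
    using gen_closed c smult_gen_zero_iff left_ideal_gen_self
    by (metis IntD1 End_ring_simps(1) self.lin_map_zero)
  finally have pc: "p \<in> annihilator (c gen)" using gen_closed by (simp add: annihilator_def)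
  then have "annihilator (c gen) = annihilator gen"
    using annihilator_generator_unique[OF cg p_atom] annihilator_gen by simp
  then obtain d where d: "d \<in> carrier C" "d (c gen) = gen"
    using End_transitive[OF cg pc atom_nonzero[OF p_atom] gen_in] by auto
  then have "c \<otimes>\<^bsub>C\<^esub> d = \<one>\<^bsub>C\<^esub>"
    using c by (intro eq) (auto simp: End_in End_apply)
  then show "\<exists>d\<in>carrier C. c \<otimes>\<^bsub>C\<^esub> d = \<one>\<^bsub>C\<^esub>" using d by blast
qed

sublocale V: right_vector_space C V by (rule right_vector_space)

end

section \<open>F-dependence and linear dependence\<close>

context two_fir
begin

lemma finite_length_carrier: "f \<in> finite_length R \<Longrightarrow> f \<in> carrier R"
  by (simp add: finite_length_def)

lemma atom_finite_length:
  assumes q: "q \<in> atoms R"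
  shows "q \<in> finite_length R - Units R"
proof -
  have "Inf {enat (length as) | as. set as \<subseteq> atoms R \<and> q = foldr (\<otimes>) as \<one>} \<le> enat (length [q])"
    by (intro Inf_lower CollectI exI[of _ "[q]"]) (use q atom_closed[OF q] in auto)
  also have "\<dots> < \<infinity>" by simp
  finally show ?thesis
    using atom_closed[OF q] atom_nonunit[OF q] by (simp add: finite_length_def elt_length_def)
qed

text \<open>A nonempty infimum in \<open>enat\<close> is attained, so a non-unit of finite length
  really is a product of that many atoms.\<close>

lemma finite_length_cases:
  assumes "f \<in> finite_length R"
  obtains "f \<in> Units R" "elt_length R f = 0"
  | as where "set as \<subseteq> atoms R" "f = foldr (\<otimes>) as \<one>" "elt_length R f = enat (length as)"
proof (cases "f \<in> Units R")
  case True
  then show ?thesis using that(1) by (simp add: elt_length_def)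
next
  case False
  let ?S = "{enat (length as) | as. set as \<subseteq> atoms R \<and> f = foldr (\<otimes>) as \<one>}"
  have "elt_length R f = Inf ?S" using False by (simp add: elt_length_def)
  moreover have "Inf ?S \<noteq> \<infinity>" using calculation assms by (simp add: finite_length_def)
  then have "?S \<noteq> {}" unfolding Inf_enat_def by meson
  then have "Inf ?S \<in> ?S" unfolding Inf_enat_def by (simp only: if_False) (rule LeastI_ex, blast)
  ultimately show ?thesis using that(2) by auto
qed

lemma foldr_atoms:
  assumes "set as \<subseteq> atoms R"
  shows "foldr (\<otimes>) as \<one> \<in> carrier R" "foldr (\<otimes>) as \<one> \<noteq> \<zero>"
proof -
  have "foldr (\<otimes>) as \<one> \<in> carrier R \<and> foldr (\<otimes>) as \<one> \<noteq> \<zero>"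
    using assms
    by (induction as) (simp_all add: one_not_zero atom_closed atom_nonzero nonzero_mult)
  then show "foldr (\<otimes>) as \<one> \<in> carrier R" "foldr (\<otimes>) as \<one> \<noteq> \<zero>" by auto
qed

lemma finite_length_nonzero:
  assumes "f \<in> finite_length R"
  shows "f \<noteq> \<zero>"
  using assms
proof (cases rule: finite_length_cases)
  case 1
  then show ?thesis using one_not_zero Units_l_inv[of f] Units_inv_closed[of f] r_null by metis
next
  case (2 as)
  then show ?thesis using foldr_atoms(2) by simp
qed

text \<open>Zero lies in every left ideal, so an intersection other than {0} contains a nonzero f.
  This common left multiple is the form in which algebraicity is used.\<close>

lemma F_algebraic_iff:
  "F_algebraic R D \<longleftrightarrow> D \<subseteq> finite_length R - Units R \<and>
     (\<exists>f\<in>carrier R. f \<noteq> \<zero> \<and> (\<forall>d\<in>D. f \<in> left_ideal_gen R d))"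
proof -
  have "\<zero> \<in> left_ideal_Inter R D" if "D \<subseteq> finite_length R - Units R"
  proof -
    have "\<zero> \<in> left_ideal_gen R d" if "d \<in> D" for d
    proof -
      have "\<zero> = \<zero> \<otimes> d" using finite_length_carrier[of d] that \<open>D \<subseteq> _\<close> by auto
      then show ?thesis unfolding left_ideal_gen_iff by blast
    qed
    then show ?thesis by (auto simp: left_ideal_Inter_def)
  qed
  then show ?thesis unfolding F_algebraic_def left_ideal_Inter_def by auto
qed

lemma F_algebraic_subset: "\<lbrakk>F_algebraic R D; A \<subseteq> D\<rbrakk> \<Longrightarrow> F_algebraic R A"
  unfolding F_algebraic_iff by (meson subset_iff)

text \<open>A finite set witnessing dependence inside \<open>A\<close> also witnesses it inside
  \<open>B\<close>. It serves to bound the finite subsets of an F-basis not yet known to be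
  finite.\<close>

lemma F_independent_subset:
  assumes B: "F_independent R B" and AB: "A \<subseteq> B"
  shows "F_independent R A"
proof -
  have alg: "F_algebraic R B" using B by (simp add: F_independent_def)
  have "\<not> F_dependent_on R d (A - {d})" if d: "d \<in> A" for d
  proof
    assume "F_dependent_on R d (A - {d})"
    then have "F_dependent_on R d (B - {d})"
      using AB d F_algebraic_subset[OF alg, of "B - {d}"] F_algebraic_subset[OF alg, of "B - {d} \<union> {d}"]
      unfolding F_dependent_on_def by blast
    then show False using B d AB by (auto simp: F_independent_def)
  qed
  then show ?thesis using F_algebraic_subset[OF alg AB] by (simp add: F_independent_def)
qed

end

context fir_atom
begin

lemma V_simps [simp]: "carrier V = carrier Q" "\<zero>\<^bsub>V\<^esub> = \<zero>\<^bsub>Q\<^esub>" "v \<oplus>\<^bsub>V\<^esub> w = v \<oplus>\<^bsub>Q\<^esub> w" "c \<odot>\<^bsub>V\<^esub> v = c v"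
  by (rule End_module_simps)+

lemma V_minus [simp]:
  assumes "v \<in> carrier Q"
  shows "\<ominus>\<^bsub>V\<^esub> v = \<ominus>\<^bsub>Q\<^esub> v"
  using assms by (intro V.M.minus_equality) (auto simp: Q.l_neg)

lemma End_map_zero: "c \<in> carrier C \<Longrightarrow> c \<zero>\<^bsub>Q\<^esub> = \<zero>\<^bsub>Q\<^esub>"
  by (simp add: End_ring_simps self.lin_map_zero)

text \<open>Scalars commute with the action of R, so whatever kills every \<open>v i\<close> kills
  all their combinations.\<close>

lemma annihilator_span:
  assumes "finite I" "v \<in> I \<rightarrow> carrier Q" "r \<in> carrier R" "\<And>i. i \<in> I \<Longrightarrow> r \<in> annihilator (v i)"
    and "m \<in> lin_span C V I v"
  shows "r \<in> annihilator m"
  using assms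
proof (induction I arbitrary: m rule: finite_induct)
  case empty
  then show ?case by (simp add: annihilator_zero)
next
  case (insert i I)
  obtain c y where c: "c \<in> carrier C" "y \<in> lin_span C V I v" "m = c \<odot>\<^bsub>V\<^esub> v i \<oplus>\<^bsub>V\<^esub> y"
    using V.span_insert_E[OF insert(1,2) _ insert(7)] insert(4) by auto
  have y: "r \<in> annihilator y" "y \<in> carrier Q"
    using insert c V.span_closed[of v I y] by auto
  have vi: "r \<odot>\<^bsub>Q\<^esub> v i = \<zero>\<^bsub>Q\<^esub>" "v i \<in> carrier Q"
    using insert.prems(1) insert.prems(3)[of i] by (auto simp: annihilator_def)
  have "r \<odot>\<^bsub>Q\<^esub> c (v i) = \<zero>\<^bsub>Q\<^esub>"
    using End_smult[OF c(1) insert(5) vi(2)] vi(1) End_map_zero[OF c(1)] by simp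
  then show ?case
    using y vi insert(5) End_closed[OF c(1) vi(2)] unfolding annihilator_def c(3)
    by (simp add: smult_r_distr)
qed

text \<open>A density argument: adjoining \<open>v j\<close> to a family with annihilator \<open>R g'\<close>, the elements
  \<open>g' m\<close> with \<open>g m = 0\<close> are the images of \<open>g' (v j)\<close> under endomorphisms \<open>c\<close>, and \<open>m - c (v j)\<close>
  is killed by \<open>g'\<close>.\<close>

lemma annihilator_family:
  assumes "finite I" "v \<in> I \<rightarrow> carrier Q" "f \<in> carrier R" "f \<noteq> \<zero>"
    and "\<And>i. i \<in> I \<Longrightarrow> f \<in> annihilator (v i)"
  shows "\<exists>g\<in>carrier R. carrier R \<inter> (\<Inter>i\<in>I. annihilator (v i)) = left_ideal_gen R g \<and>
    (\<forall>m\<in>carrier Q. g \<in> annihilator m \<longrightarrow> m \<in> lin_span C V I v)"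
  using assms
proof (induction I rule: finite_induct)
  case empty
  have "left_ideal_gen R \<one> = carrier R" by (force simp: left_ideal_gen_def)
  then show ?case using one_in_annihilator by (intro bexI[of _ \<one>]) auto
next
  case (insert j I)
  have v: "v \<in> I \<rightarrow> carrier Q" "v j \<in> carrier Q" using insert.prems(1) by auto
  obtain g where g: "g \<in> carrier R" "carrier R \<inter> (\<Inter>i\<in>I. annihilator (v i)) = left_ideal_gen R g"
    and gspan: "\<And>m. \<lbrakk>m \<in> carrier Q; g \<in> annihilator m\<rbrakk> \<Longrightarrow> m \<in> lin_span C V I v"
    using insert.IH[OF v(1) insert.prems(2,3)] insert.prems(4) by auto
  have span_sub: "lin_span C V I v \<subseteq> lin_span C V (insert j I) v"
    using insert by (intro V.span_mono) auto
  let ?w = "g \<odot>\<^bsub>Q\<^esub> v j"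
  have w: "?w \<in> carrier Q" using g v by simp
  have fam: "x \<in> carrier R \<inter> (\<Inter>i\<in>insert j I. annihilator (v i)) \<longleftrightarrow>
      x \<in> left_ideal_gen R g \<and> x \<in> annihilator (v j)" for x
    using g(2) by blast
  show ?case
  proof (cases "?w = \<zero>\<^bsub>Q\<^esub>")
    case True
    then have "g \<in> annihilator (v j)" using g by (simp add: annihilator_def)
    then have "left_ideal_gen R g \<subseteq> annihilator (v j)"
      by (auto simp: left_ideal_gen_iff[of _ g] intro: annihilator_left_ideal[OF v(2)])
    then show ?thesis using g(1) gspan fam span_sub by (intro bexI[of _ g]) blast+
  next
    case False
    have "f \<in> left_ideal_gen R g" using g(2) insert.prems(2,4) by blast
    \<comment> \<open>The cofactor \<open>h0\<close> of f kills g (v j), so this nonzero element is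
      torsion and its annihilator is principal.\<close>
    then obtain h0 where h0: "h0 \<in> carrier R" "f = h0 \<otimes> g" unfolding left_ideal_gen_iff by blast
    have h0nz: "h0 \<noteq> \<zero>" using insert.prems(3) h0 g(1) by auto
    have "f \<odot>\<^bsub>Q\<^esub> v j = \<zero>\<^bsub>Q\<^esub>" using insert.prems(4)[of j] by (simp add: annihilator_def)
    then have h0w: "h0 \<in> annihilator ?w" using h0 g(1) v(2) by (simp add: annihilator_def smult_assoc)
    obtain h where h: "h \<in> carrier R" "annihilator ?w = left_ideal_gen R h"
      using torsion_generates(2)[OF w False h0w h0nz] by blast
    \<comment> \<open>An element s g of Rg kills \<open>v j\<close> exactly when s kills g (v j),
      that is, when s lies in Rh.\<close>
    have "carrier R \<inter> (\<Inter>i\<in>insert j I. annihilator (v i)) = left_ideal_gen R (h \<otimes> g)"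
    proof (intro equalityI subsetI)
      fix x assume "x \<in> carrier R \<inter> (\<Inter>i\<in>insert j I. annihilator (v i))"
      then obtain s where s: "s \<in> carrier R" "x = s \<otimes> g" "x \<in> annihilator (v j)"
        unfolding fam left_ideal_gen_iff by blast
      then have "s \<in> annihilator ?w" using g(1) v(2) by (simp add: annihilator_def smult_assoc)
      then obtain t where "t \<in> carrier R" "s = t \<otimes> h" using h(2) left_ideal_gen_iff by blast
      then show "x \<in> left_ideal_gen R (h \<otimes> g)"
        unfolding left_ideal_gen_iff using s(2) h(1) g(1) by (metis m_assoc)
    next
      fix x assume "x \<in> left_ideal_gen R (h \<otimes> g)"
      then obtain t where t: "t \<in> carrier R" "x = t \<otimes> (h \<otimes> g)" unfolding left_ideal_gen_iff by blast
      then have x: "x = (t \<otimes> h) \<otimes> g" using h(1) g(1) by (simp add: m_assoc)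
      have "t \<otimes> h \<in> annihilator ?w" using h(2) left_ideal_gen_iff t(1) by blast
      then have "x \<in> annihilator (v j)"
        unfolding x using t(1) h(1) g(1) v(2) by (simp add: annihilator_def smult_assoc)
      moreover have "x \<in> left_ideal_gen R g" unfolding left_ideal_gen_iff using x t(1) h(1) by blast
      ultimately show "x \<in> carrier R \<inter> (\<Inter>i\<in>insert j I. annihilator (v i))" unfolding fam by blast
    qed
    moreover have "m \<in> lin_span C V (insert j I) v"
      if m: "m \<in> carrier Q" "h \<otimes> g \<in> annihilator m" for m
    proof -
      have gm: "g \<odot>\<^bsub>Q\<^esub> m \<in> carrier Q" using g m by simp
      have "h \<in> annihilator (g \<odot>\<^bsub>Q\<^esub> m)" using m h(1) g(1) by (simp add: annihilator_def smult_assoc)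
      then have "annihilator ?w \<subseteq> annihilator (g \<odot>\<^bsub>Q\<^esub> m)"
        unfolding h(2) by (auto simp: left_ideal_gen_iff[of _ h] intro: annihilator_left_ideal[OF gm])
      then obtain c where c: "c \<in> carrier C" "c ?w = g \<odot>\<^bsub>Q\<^esub> m"
        using End_transitive[OF w False h0w h0nz gm] by blast
      let ?d = "m \<ominus>\<^bsub>Q\<^esub> c (v j)"
      have cv: "c (v j) \<in> carrier Q" using End_closed[OF c(1) v(2)] .
      have "g \<odot>\<^bsub>Q\<^esub> ?d = \<zero>\<^bsub>Q\<^esub>"
        using c(2) g(1) m(1) cv End_smult[OF c(1) g(1) v(2)]
        by (simp add: Q.minus_eq smult_r_distr smult_minus_right Q.r_neg)
      then have "?d \<in> lin_span C V I v"
        using gspan[of ?d] g(1) m(1) cv by (simp add: annihilator_def)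
      then have "c \<odot>\<^bsub>V\<^esub> v j \<oplus>\<^bsub>V\<^esub> ?d \<in> lin_span C V (insert j I) v"
        using c(1) insert by (intro V.span_insert_I) auto
      moreover have "c (v j) \<oplus>\<^bsub>Q\<^esub> ?d = m"
        using cv m(1) by (simp add: Q.minus_eq Q.a_lcomm[of "c (v j)" m] Q.r_neg)
      ultimately show ?thesis by simp
    qed
    ultimately show ?thesis using h(1) g(1) by (intro bexI[of _ "h \<otimes> g"]) auto
  qed
qed

lemma F_dependent_on_iff_span:
  assumes fin: "finite I" and q: "q \<in> I \<rightarrow> atoms R" and v: "v \<in> I \<rightarrow> carrier Q"
    and ann: "\<And>i. i \<in> I \<Longrightarrow> annihilator (v i) = left_ideal_gen R (q i)"
    and d: "d \<in> atoms R" and m: "m \<in> carrier Q" "annihilator m = left_ideal_gen R d"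
    and f: "f \<in> carrier R" "f \<noteq> \<zero>" "\<And>i. i \<in> I \<Longrightarrow> f \<in> left_ideal_gen R (q i)" "f \<in> left_ideal_gen R d"
  shows "F_dependent_on R d (q ` I) \<longleftrightarrow> m \<in> lin_span C V I v"
proof -
  have alg: "F_algebraic R (q ` I \<union> {d})"
    unfolding F_algebraic_iff using q d f atom_finite_length by blast
  have comax: "left_ideal_gen R d <+>\<^bsub>R\<^esub> left_ideal_Inter R (q ` J) \<noteq> carrier R \<longleftrightarrow> m \<in> lin_span C V J v"
    if J: "J \<subseteq> I" for J
  proof -
    have finJ: "finite J" using J fin finite_subset by blast
    have vJ: "v \<in> J \<rightarrow> carrier Q" using J v by auto
    have annJ: "annihilator (v i) = left_ideal_gen R (q i)" if "i \<in> J" for i using ann J that by blast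
    have fJ: "f \<in> annihilator (v i)" if "i \<in> J" for i using f(3) annJ J that by blast
    obtain g where g: "g \<in> carrier R" "carrier R \<inter> (\<Inter>i\<in>J. annihilator (v i)) = left_ideal_gen R g"
      and gspan: "\<And>m. \<lbrakk>m \<in> carrier Q; g \<in> annihilator m\<rbrakk> \<Longrightarrow> m \<in> lin_span C V J v"
      using annihilator_family[OF finJ vJ f(1,2) fJ] by blast
    have "left_ideal_Inter R (q ` J) = left_ideal_gen R g"
      unfolding left_ideal_Inter_def g(2)[symmetric] using annJ by auto
    moreover have "f \<in> left_ideal_gen R g" using g(2) f(1) fJ by blast
    ultimately have "left_ideal_gen R d <+>\<^bsub>R\<^esub> left_ideal_Inter R (q ` J) \<noteq> carrier R \<longleftrightarrow> g \<in> annihilator m"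
      using atom_comaximal_iff[OF d g(1) f(4) _ f(2)] m(2) by simp
    moreover have "g \<in> annihilator m" if "m \<in> lin_span C V J v"
      using annihilator_span[OF finJ vJ g(1) _ that] g left_ideal_gen_self[OF g(1)] by blast
    ultimately show ?thesis using gspan[OF m(1)] by blast
  qed
  have "(\<exists>G. finite G \<and> G \<subseteq> q ` I \<and> left_ideal_gen R d <+>\<^bsub>R\<^esub> left_ideal_Inter R G \<noteq> carrier R) \<longleftrightarrow>
      m \<in> lin_span C V I v"
  proof
    assume "\<exists>G. finite G \<and> G \<subseteq> q ` I \<and> left_ideal_gen R d <+>\<^bsub>R\<^esub> left_ideal_Inter R G \<noteq> carrier R"
    then obtain J where J: "J \<subseteq> I" "left_ideal_gen R d <+>\<^bsub>R\<^esub> left_ideal_Inter R (q ` J) \<noteq> carrier R"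
      unfolding subset_image_iff by blast
    then show "m \<in> lin_span C V I v" using comax[OF J(1)] V.span_mono[OF fin J(1)] v by auto
  next
    assume "m \<in> lin_span C V I v"
    then show "\<exists>G. finite G \<and> G \<subseteq> q ` I \<and> left_ideal_gen R d <+>\<^bsub>R\<^esub> left_ideal_Inter R G \<noteq> carrier R"
      using comax[OF order_refl] fin by blast
  qed
  then show ?thesis
    unfolding F_dependent_on_def
    using alg F_algebraic_subset[OF alg, of "q ` I"] atom_finite_length[OF d] by blast
qed

text \<open>Injectivity of q matters here: only then does removing the atom \<open>q i\<close> from
  the set amount to removing the single index i from the family.\<close>

lemma F_independent_iff:
  assumes fin: "finite I" and inj: "inj_on q I" and q: "q \<in> I \<rightarrow> atoms R" and v: "v \<in> I \<rightarrow> carrier Q"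
    and ann: "\<And>i. i \<in> I \<Longrightarrow> annihilator (v i) = left_ideal_gen R (q i)"
    and f: "f \<in> carrier R" "f \<noteq> \<zero>" "\<And>i. i \<in> I \<Longrightarrow> f \<in> left_ideal_gen R (q i)"
  shows "F_independent R (q ` I) \<longleftrightarrow> \<not> lin_dependent C V I v"
proof -
  have "F_dependent_on R (q i) (q ` I - {q i}) \<longleftrightarrow> v i \<in> lin_span C V (I - {i}) v" if i: "i \<in> I" for i
  proof -
    have "q ` I - {q i} = q ` (I - {i})" using inj i by (auto simp: inj_on_def)
    then show ?thesis
      using F_dependent_on_iff_span[of "I - {i}" q v "q i" "v i" f] fin q v ann f i by (auto simp: Pi_iff)
  qed
  moreover have "F_algebraic R (q ` I)"
    unfolding F_algebraic_iff using q f atom_finite_length by blast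
  ultimately show ?thesis
    unfolding F_independent_def using V.dependent_iff[OF fin, of v] v by auto
qed

section \<open>Independent families killed by f, bounded by the length of f\<close>

lemma card_le_of_annihilator_unit:
  assumes "finite I" "v \<in> I \<rightarrow> carrier Q" "f \<in> Units R" "\<And>i. i \<in> I \<Longrightarrow> f \<in> annihilator (v i)"
    and indep: "\<not> lin_dependent C V I v"
  shows "I = {}"
proof (rule ccontr)
  assume "I \<noteq> {}"
  then obtain i where i: "i \<in> I" by blast
  then have vi: "v i \<in> carrier Q" using assms by auto
  have "inv f \<otimes> f \<in> annihilator (v i)"
    using annihilator_left_ideal[OF vi assms(4)[OF i] Units_inv_closed[OF assms(3)]] .
  then have "v i = \<zero>\<^bsub>Q\<^esub>" using one_in_annihilator[OF vi] Units_l_inv[OF assms(3)] by simp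
  then have "v i \<in> lin_span C V (I - {i}) v"
    using V.span_zero[of v "I - {i}"] assms(2) by auto
  then show False using V.dependent_iff[OF assms(1), of v] assms(2) i indep by auto
qed

text \<open>Each atom split off on the left costs at most one vector. Write the product as a f'. If
  f' does not kill the whole family, pick i0 with f' (v i0) nonzero; every f' (v i) is killed by a,
  hence is a multiple of f' (v i0). Eliminating with pivot \<open>v i0\<close> leaves an independent
  family killed by f'.\<close>

lemma card_le_length_atoms:
  assumes "set as \<subseteq> atoms R" "finite I" "v \<in> I \<rightarrow> carrier Q"
    and "\<And>i. i \<in> I \<Longrightarrow> foldr (\<otimes>) as \<one> \<in> annihilator (v i)"
    and "\<not> lin_dependent C V I v"
  shows "card I \<le> length as"
  using assms
proof (induction as arbitrary: I v)
  case Nil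
  then show ?case using card_le_of_annihilator_unit[of I v \<one>] by simp
next
  case (Cons a as)
  let ?f = "foldr (\<otimes>) as \<one>"
  have as: "set as \<subseteq> atoms R" and a: "a \<in> atoms R" using Cons.prems(1) by auto
  note f = foldr_atoms(1)[OF as] and ac = atom_closed[OF a]
  have v: "v i \<in> carrier Q" if "i \<in> I" for i using Cons.prems(3) that by auto
  have afv: "a \<in> annihilator (?f \<odot>\<^bsub>Q\<^esub> v i)" if "i \<in> I" for i
    using Cons.prems(4)[OF that] v[OF that] f ac by (simp add: annihilator_def smult_assoc)
  show ?case
  proof (cases "\<forall>i\<in>I. ?f \<in> annihilator (v i)")
    case True
    then show ?thesis using Cons.IH[OF as Cons.prems(2,3) _ Cons.prems(5)] by simp
  next
    case False
    then obtain i0 where i0: "i0 \<in> I" "?f \<notin> annihilator (v i0)" by blast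
    let ?w = "?f \<odot>\<^bsub>Q\<^esub> v i0"
    have w: "?w \<in> carrier Q" "?w \<noteq> \<zero>\<^bsub>Q\<^esub>" using i0 v f by (auto simp: annihilator_def)
    \<comment> \<open>The atom a kills the nonzero \<open>?w\<close>, so the annihilator of
      \<open>?w\<close> is exactly Ra and is contained in that of every element killed by a.\<close>
    have "\<exists>c\<in>carrier C. c ?w = ?f \<odot>\<^bsub>Q\<^esub> v i" if i: "i \<in> I" for i
    proof -
      have fv: "?f \<odot>\<^bsub>Q\<^esub> v i \<in> carrier Q" using v[OF i] f by simp
      have "annihilator ?w \<subseteq> annihilator (?f \<odot>\<^bsub>Q\<^esub> v i)"
        unfolding annihilator_generator_unique[OF w a afv[OF i0(1)]]
        by (auto simp: left_ideal_gen_iff[of _ a] intro: annihilator_left_ideal[OF fv afv[OF i]])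
      then show ?thesis
        using End_transitive[OF w afv[OF i0(1)] atom_nonzero[OF a] fv] by blast
    qed
    then obtain c where c: "\<And>i. i \<in> I \<Longrightarrow> c i \<in> carrier C" "\<And>i. i \<in> I \<Longrightarrow> c i ?w = ?f \<odot>\<^bsub>Q\<^esub> v i"
      by metis
    have cv: "c i (v i0) \<in> carrier Q" if "i \<in> I" for i using End_closed[OF c(1)[OF that] v[OF i0(1)]] .
    let ?u = "\<lambda>i. v i \<ominus>\<^bsub>V\<^esub> c i \<odot>\<^bsub>V\<^esub> v i0"
    have u: "?u i = v i \<ominus>\<^bsub>Q\<^esub> c i (v i0)" if "i \<in> I" for i
      using cv[OF that] by (simp add: V.M.minus_eq Q.minus_eq)
    have "\<not> lin_dependent C V (I - {i0}) ?u"
      using V.independent_eliminate[OF Cons.prems(2) _ i0(1) _ Cons.prems(5)] Cons.prems(3) c(1) by auto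
    moreover have "?u \<in> I - {i0} \<rightarrow> carrier Q"
      using u cv v by auto
    moreover have "?f \<in> annihilator (?u i)" if "i \<in> I - {i0}" for i
    proof -
      have i: "i \<in> I" using that by simp
      have "?f \<odot>\<^bsub>Q\<^esub> (v i \<ominus>\<^bsub>Q\<^esub> c i (v i0)) = \<zero>\<^bsub>Q\<^esub>"
        using f v[OF i] cv[OF i] c(2)[OF i] End_smult[OF c(1)[OF i] f v[OF i0(1)]]
        by (simp add: Q.minus_eq smult_r_distr smult_minus_right Q.r_neg)
      then show ?thesis using u[OF i] f by (simp add: annihilator_def)
    qed
    ultimately have "card (I - {i0}) \<le> length as"
      using Cons.IH[OF as, of "I - {i0}" ?u] Cons.prems(2) by blast
    then show ?thesis using Cons.prems(2) i0(1) by simp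
  qed
qed

lemma card_le_elt_length:
  assumes f: "f \<in> finite_length R" and fin: "finite I" and v: "v \<in> I \<rightarrow> carrier Q"
    and ann: "\<And>i. i \<in> I \<Longrightarrow> f \<in> annihilator (v i)" and indep: "\<not> lin_dependent C V I v"
  shows "enat (card I) \<le> elt_length R f"
  using f
proof (cases rule: finite_length_cases)
  case 1
  then show ?thesis using card_le_of_annihilator_unit[OF fin v _ ann indep] by (simp add: zero_enat_def)
next
  case (2 as)
  then show ?thesis using card_le_length_atoms[OF 2(1) fin v _ indep] ann by simp
qed

text \<open>The preimage of 1 + Rq under an isomorphism from R/Rp to R/Rq has the annihilator
  Rq.\<close>

lemma similarity_class_representative:
  assumes "q \<in> similarity_class R p"
  shows "\<exists>m\<in>carrier Q. annihilator m = left_ideal_gen R q"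
proof -
  have q: "q \<in> carrier R" using assms by (simp add: similarity_class_def)
  interpret P: quot_pair R p q by unfold_locales (rule q)
  obtain h where h: "h \<in> lin_isos R Q (quot_module R q)"
    using assms by (auto simp: similarity_class_def)
  then have "h ` carrier Q = carrier (quot_module R q)" by (simp add: lin_isos_def bij_betw_def)
  then have "P.B.gen \<in> h ` carrier Q" using P.B.gen_in by simp
  then obtain m where m: "m \<in> carrier Q" "h m = P.B.gen" by (metis imageE)
  then show ?thesis using P.annihilator_iso[OF h m(1)] P.B.annihilator_gen by auto
qed

section \<open>The kernel of left multiplication by f and the roots of f\<close>

lemma lmult_ker_eq: "lmult_ker R f p = {m \<in> carrier Q. f \<odot>\<^bsub>Q\<^esub> m = \<zero>\<^bsub>Q\<^esub>}"
  by (simp add: lmult_ker_def lmult_def a_kernel_def')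

lemma lmult_ker_space_eq: "lmult_ker_space R f p = V\<lparr>carrier := lmult_ker R f p\<rparr>"
  by (simp add: lmult_ker_space_def C_space_def)

lemma lmult_ker_space:
  assumes f: "f \<in> carrier R"
  shows "right_vector_space C (V\<lparr>carrier := lmult_ker R f p\<rparr>)"
proof (rule V.subspace)
  fix c x assume c: "c \<in> carrier C" and x: "x \<in> lmult_ker R f p"
  then have "f \<odot>\<^bsub>Q\<^esub> c x = c \<zero>\<^bsub>Q\<^esub>" using End_smult[OF c f, of x] by (simp add: lmult_ker_eq)
  also have "\<dots> = \<zero>\<^bsub>Q\<^esub>" using c by (rule End_map_zero)
  finally show "c \<odot>\<^bsub>V\<^esub> x \<in> lmult_ker R f p" using c x End_closed by (simp add: lmult_ker_eq)
qed (use f in \<open>auto simp: lmult_ker_eq smult_r_distr\<close>)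

text \<open>Each root d in S gets a representative \<open>\<mu> d\<close> with annihilator Rd; f
  kills all of them. Conversely every nonzero kernel element has an annihilator Rd with d in S, so
  it is a scalar multiple of \<open>\<mu> d\<close>. Hence \<open>\<mu>\<close> maps an F-basis to a
  basis of the kernel. An F-basis exists because independent sets of roots have bounded size, so one
  of largest size can be chosen, although S itself may be infinite.\<close>

lemma left_roots_basis:
  assumes f: "f \<in> finite_length R"
  defines "S \<equiv> left_roots R f \<inter> similarity_class R p"
  shows "\<exists>B. F_basis R S B"
    and "F_basis R S B \<Longrightarrow> finite B \<and>
      lin_dim C (lmult_ker_space R f p) = enat (card B) \<and> enat (card B) \<le> elt_length R f"
proof -
  note fc = finite_length_carrier[OF f] and fnz = finite_length_nonzero[OF f]
  have S: "d \<in> atoms R" "f \<in> left_ideal_gen R d" if "d \<in> S" for d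
    using that by (auto simp: S_def left_roots_def)
  have "\<exists>m\<in>carrier Q. annihilator m = left_ideal_gen R d" if "d \<in> S" for d
    using similarity_class_representative[of d] that by (simp add: S_def)
  then obtain \<mu> where \<mu>: "\<And>d. d \<in> S \<Longrightarrow> \<mu> d \<in> carrier Q"
    "\<And>d. d \<in> S \<Longrightarrow> annihilator (\<mu> d) = left_ideal_gen R d"
    by metis
  have ker: "f \<in> annihilator (\<mu> d)" if "d \<in> S" for d using \<mu>(2) S that by blast
  have indep_iff: "F_independent R B \<longleftrightarrow> \<not> lin_dependent C V B \<mu>" if B: "finite B" "B \<subseteq> S" for B
    using F_independent_iff[of B "\<lambda>d. d" \<mu> f] B S \<mu> fc fnz by (auto simp: subset_iff)
  have dep_iff: "F_dependent_on R d B \<longleftrightarrow> \<mu> d \<in> lin_span C V B \<mu>"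
    if B: "finite B" "B \<subseteq> S" and d: "d \<in> S" for B d
    using F_dependent_on_iff_span[of B "\<lambda>d. d" \<mu> d "\<mu> d" f] B S \<mu> fc fnz d by (auto simp: subset_iff)
  have bound: "enat (card B) \<le> elt_length R f" if B: "finite B" "B \<subseteq> S" "\<not> lin_dependent C V B \<mu>" for B
    using card_le_elt_length[OF f B(1) _ _ B(3)] B(2) \<mu>(1) ker by blast
  obtain N where N: "elt_length R f = enat N" using f by (auto simp: finite_length_def)
  show "\<exists>B. F_basis R S B"
  proof -
    let ?P = "\<lambda>B. finite B \<and> B \<subseteq> S \<and> \<not> lin_dependent C V B \<mu>"
    have "?P {}" by (simp add: lin_dependent_def)
    moreover have "\<forall>B. ?P B \<longrightarrow> card B < Suc N" using bound N by (auto simp: less_Suc_eq_le)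
    ultimately obtain B where B: "?P B" and max: "\<And>A. ?P A \<Longrightarrow> card A \<le> card B"
      using ex_has_greatest_nat[of ?P "{}" card "Suc N"] by blast
    have "\<mu> d \<in> lin_span C V B \<mu>" if d: "d \<in> S" for d
    proof (rule ccontr)
      assume nd: "\<mu> d \<notin> lin_span C V B \<mu>"
      have \<mu>B: "\<mu> \<in> insert d B \<rightarrow> carrier V" using B d \<mu>(1) by auto
      then have dB: "d \<notin> B" using nd V.span_member[of B \<mu> d] B by auto
      then have "?P (insert d B)" using V.independent_insert[OF _ dB \<mu>B] B nd d by blast
      then show False using max[of "insert d B"] card_insert_disjoint[of B d] dB B by linarith
    qed
    then have "F_basis R S B"
      unfolding F_basis_def using B indep_iff dep_iff by blast
    then show ?thesis by blast
  qed
  show "finite B \<and> lin_dim C (lmult_ker_space R f p) = enat (card B) \<and> enat (card B) \<le> elt_length R f"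
    if B: "F_basis R S B"
  proof -
    have BS: "B \<subseteq> S" and Bi: "F_independent R B" using B by (auto simp: F_basis_def)
    \<comment> \<open>\<open>B\<close> may a priori be infinite, whereas \<open>indep_iff\<close>
      and \<open>bound\<close> concern finite sets; so they are applied to its finite
      subsets.\<close>
    have "card A \<le> N" if A: "finite A" "A \<subseteq> B" for A
      using bound[of A] indep_iff[of A] F_independent_subset[OF Bi A(2)] A BS N by auto
    then have fin: "finite B"
      using infinite_arbitrarily_large[of B "Suc N"] by (metis not_less_eq_eq order_refl)
    have indep: "\<not> lin_dependent C V B \<mu>" using indep_iff[OF fin BS] Bi by blast
    have span: "\<mu> d \<in> lin_span C V B \<mu>" if "d \<in> S" for d
      using dep_iff[OF fin BS that] B that by (auto simp: F_basis_def)
    have \<mu>B: "\<mu> \<in> B \<rightarrow> carrier V" using BS \<mu>(1) by auto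
    let ?W = "lmult_ker R f p"
    have WV: "?W \<subseteq> carrier V" by (auto simp: lmult_ker_eq)
    interpret W: right_vector_space C "V\<lparr>carrier := ?W\<rparr>" by (rule lmult_ker_space[OF fc])
    have \<mu>W: "\<mu> \<in> B \<rightarrow> ?W" using BS \<mu>(1) ker by (auto simp: lmult_ker_eq annihilator_def)
    have "x \<in> lin_span C V B \<mu>" if x: "x \<in> ?W" for x
    proof (cases "x = \<zero>\<^bsub>Q\<^esub>")
      case True
      then show ?thesis using V.span_zero[OF \<mu>B] by simp
    next
      case False
      have xQ: "x \<in> carrier Q" and fx: "f \<in> annihilator x"
        using x fc by (auto simp: lmult_ker_eq annihilator_def)
      \<comment> \<open>The annihilator of \<open>x\<close> contains the nonzero f, so its generator
        is nonzero; being then an atom, similar to p and a right divisor of f, it belongs to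
        S.\<close>
      obtain d where d: "d \<in> carrier R" "annihilator x = left_ideal_gen R d"
        using torsion_generates(2)[OF xQ False fx fnz] by blast
      have dnz: "d \<noteq> \<zero>" using fx fnz d(2) left_ideal_gen_iff[of f d] by auto
      have dS: "d \<in> S"
        using annihilator_generator_atom[OF xQ False d(1) dnz d(2)]
          annihilator_generator_similar[OF xQ False d(1) dnz d(2)] fx d(2)
        by (simp add: S_def left_roots_def)
      have \<mu>nz: "\<mu> d \<noteq> \<zero>\<^bsub>Q\<^esub>"
        using one_in_annihilator[OF xQ] one_in_annihilator[OF \<mu>(1)[OF dS]] d(2) \<mu>(2)[OF dS] False by simp
      \<comment> \<open>\<open>x\<close> and \<open>\<mu> d\<close> have the same annihilator, so a
        scalar carries \<open>\<mu> d\<close>, which lies in the span, to \<open>x\<close>.\<close>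
      obtain c where c: "c \<in> carrier C" "c (\<mu> d) = x"
        using End_transitive[OF \<mu>(1)[OF dS] \<mu>nz ker[OF dS] fnz xQ] d(2) \<mu>(2)[OF dS] by auto
      then show ?thesis using V.span_smult[OF fin \<mu>B span[OF dS] c(1)] by simp
    qed
    then have "lin_dim C (V\<lparr>carrier := ?W\<rparr>) = enat (card B)"
      using \<mu>W indep V.dependent_subspace[OF W.right_vector_space_axioms WV fin \<mu>W]
        V.span_subspace[OF W.right_vector_space_axioms WV fin \<mu>W]
      by (intro W.lin_dim_eq_card[OF fin]) auto
    then show ?thesis using fin bound[OF fin BS indep] by (simp add: lmult_ker_space_eq)
  qed
qed

lemma lmult_lin_map:
  assumes f: "f \<in> carrier R"
  shows "lmult R f p \<in> lin_maps C V V"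
  unfolding lin_maps_def hom_def lmult_def
  using f by (auto simp: smult_r_distr End_smult)

end

theorem theorem4p13:
  fixes R (structure) and p
  assumes "two_fir R" and "p \<in> atoms R"
  shows
    "(\<forall>f \<in> finite_length R.
        (\<forall>x \<in> carrier R.
           lmult R f p (left_ideal_gen R p +> x) = left_ideal_gen R p +> (f \<otimes> x)) \<and>
        lmult R f p \<in> lin_maps (C_ring R p) (C_space R p) (C_space R p) \<and>
        lmult_ker R f p =
          {left_ideal_gen R p +> x | x. x \<in> carrier R \<and> f \<otimes> x \<in> left_ideal_gen R p} \<and>
        lin_dim (C_ring R p) (lmult_ker_space R f p) \<le> elt_length R f)
     \<and>
     (\<forall>D n q \<phi>.
        F_algebraic R D \<and> D \<subseteq> similarity_class R p \<and>
        inj_on q {1..n::nat} \<and> q ` {1..n} \<subseteq> D \<and>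
        (\<forall>i \<in> {1..n}. \<phi> i \<in> lin_isos R (quot_module R (q i)) (quot_module R p)) \<longrightarrow>
        (\<not> F_independent R (q ` {1..n}) \<longleftrightarrow>
           lin_dependent (C_ring R p) (C_space R p) {1..n}
             (\<lambda>i. \<phi> i (left_ideal_gen R (q i) +> \<one>))))
     \<and>
     (\<forall>f \<in> finite_length R.
        lin_dim (C_ring R p) (lmult_ker_space R f p) =
          F_rank R (left_roots R f \<inter> similarity_class R p))"
proof -
  interpret two_fir R by fact
  interpret fir_atom R p by unfold_locales fact
  note CV = C_ring_def[of R p] C_space_def[of R p]
  have smult: "lmult R f p (left_ideal_gen R p +> x) = left_ideal_gen R p +> (f \<otimes> x)"
    if "f \<in> carrier R" "x \<in> carrier R" for f x
    using that gen_closed by (simp add: lmult_def quot_smult)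
  have kernel: "lmult_ker R f p =
      {left_ideal_gen R p +> x | x. x \<in> carrier R \<and> f \<otimes> x \<in> left_ideal_gen R p}"
    if f: "f \<in> carrier R" for f
  proof -
    have "f \<odot>\<^bsub>Q\<^esub> (left_ideal_gen R p +> x) = \<zero>\<^bsub>Q\<^esub> \<longleftrightarrow> f \<otimes> x \<in> left_ideal_gen R p"
      if "x \<in> carrier R" for x
      using that f gen_closed quot_module_zero_iff[of p "f \<otimes> x"] by (simp add: quot_smult)
    then show ?thesis unfolding lmult_ker_eq quot_module_carrier by blast
  qed
  have dim_rank: "lin_dim C (lmult_ker_space R f p) \<le> elt_length R f"
    "lin_dim C (lmult_ker_space R f p) = F_rank R (left_roots R f \<inter> similarity_class R p)"
    if f: "f \<in> finite_length R" for f
  proof -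
    let ?S = "left_roots R f \<inter> similarity_class R p"
    \<comment> \<open>All F-bases share the cardinality given by the dimension, which is what makes
      the definite description in \<open>F_rank\<close> determined.\<close>
    have basis: "ecard B = lin_dim C (lmult_ker_space R f p)" if "F_basis R ?S B" for B
      using left_roots_basis(2)[OF f that] by (simp add: ecard_def)
    obtain B where B: "F_basis R ?S B" using left_roots_basis(1)[OF f] by blast
    then show "lin_dim C (lmult_ker_space R f p) \<le> elt_length R f"
      using left_roots_basis(2)[OF f B] by simp
    show "lin_dim C (lmult_ker_space R f p) = F_rank R ?S"
      unfolding F_rank_def using B basis by (intro the_equality[symmetric]) metis+
  qed
  have dependence: "\<not> F_independent R (q ` {1..n}) \<longleftrightarrow>
      lin_dependent C V {1..n} (\<lambda>i. \<phi> i (left_ideal_gen R (q i) +> \<one>))"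
    if D: "F_algebraic R D" "D \<subseteq> similarity_class R p" and q: "inj_on q {1..n::nat}" "q ` {1..n} \<subseteq> D"
      and \<phi>: "\<And>i. i \<in> {1..n} \<Longrightarrow> \<phi> i \<in> lin_isos R (quot_module R (q i)) (quot_module R p)"
    for D n q \<phi>
  proof -
    let ?v = "\<lambda>i. \<phi> i (left_ideal_gen R (q i) +> \<one>)"
    obtain f where f: "f \<in> carrier R" "f \<noteq> \<zero>" "\<And>d. d \<in> D \<Longrightarrow> f \<in> left_ideal_gen R d"
      using D(1) unfolding F_algebraic_iff by (meson subset_iff)
    have v: "?v i \<in> carrier Q" "annihilator (?v i) = left_ideal_gen R (q i)" "q i \<in> atoms R"
      if i: "i \<in> {1..n}" for i
    proof -
      have qD: "q i \<in> D" using q(2) i by blast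
      then have qi: "q i \<in> carrier R" "q i \<noteq> \<zero>" "q i \<notin> Units R"
        using D by (auto simp: similarity_class_def F_algebraic_def)
      interpret P: quot_pair R "q i" p by unfold_locales (rule qi(1))
      have lin: "\<phi> i \<in> lin_maps R (quot_module R (q i)) Q" using \<phi>[OF i] by (simp add: lin_isos_def)
      show vi: "?v i \<in> carrier Q" using P.lin_map_closed[OF lin P.A.gen_in] by (simp add: P.A.gen_def)
      show ann: "annihilator (?v i) = left_ideal_gen R (q i)"
        using P.annihilator_iso[OF \<phi>[OF i] P.A.gen_in] P.A.annihilator_gen by (simp add: P.A.gen_def)
      \<comment> \<open>Membership in D gives only a nonzero non-unit \<open>q i\<close> similar to
        p. It is an atom because it generates the annihilator of an element of R/Rp, and that
        element is nonzero since 1 does not annihilate it.\<close>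
      have "\<one> \<notin> left_ideal_gen R (q i)"
        using unit_of_left_inverse(1)[OF qi(1)] qi(3) left_ideal_gen_iff by metis
      then have "?v i \<noteq> \<zero>\<^bsub>Q\<^esub>" using one_in_annihilator[OF vi] ann by blast
      then show "q i \<in> atoms R" using annihilator_generator_atom[OF vi _ qi(1,2) ann] by blast
    qed
    have "F_independent R (q ` {1..n}) \<longleftrightarrow> \<not> lin_dependent C V {1..n} ?v"
      using q(2) v by (intro F_independent_iff[OF _ q(1) _ _ _ f(1,2)]) (auto intro!: f(3))
    then show ?thesis by blast
  qed
  show ?thesis
    unfolding CV
  proof (intro conjI ballI allI impI)
    fix D n q \<phi>
    assume "F_algebraic R D \<and> D \<subseteq> similarity_class R p \<and> inj_on q {1..n::nat} \<and> q ` {1..n} \<subseteq> D \<and>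
      (\<forall>i \<in> {1..n}. \<phi> i \<in> lin_isos R (quot_module R (q i)) (quot_module R p))"
    then show "\<not> F_independent R (q ` {1..n}) \<longleftrightarrow>
      lin_dependent C V {1..n} (\<lambda>i. \<phi> i (left_ideal_gen R (q i) +> \<one>))"
      by (intro dependence[of D]) simp_all
  qed (simp_all only: smult kernel dim_rank(1) lmult_lin_map finite_length_carrier, rule dim_rank(2))
qed

end
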